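(* Let $c$ be a real number with $1 < c < \frac 32$, and let $\varepsilon > 0$. For $x \ge 2$ let $E_c(x)$ denote the number of positive integers $n \le x$ that cannot be represented in the form $[m^c] + [p^c] = n$ with $m$ an integer and $p$ a prime. Then \[ E_c(x) \ll x^{3(1 - 1/c) + \varepsilon}, \] where the implied constant depends at most on $c$ and $\varepsilon$.
   Context: $[\theta]$ denotes the integral part (floor) of a real number $\theta$. The notation $A \ll B$ means $|A| \le C B$ for some constant $C>0$. *)

theory Defs
  imports "HOL-Analysis.Analysis" "HOL-Computational_Algebra.Primes"
begin

text \<open>
  For non-integral \<open>c\<close> the real power \<open>m\<^sup>c\<close> is meaningful only for
  \<open>m \<ge> 0\<close>, so the integer \<open>m\<close> is restricted to nonnegative values; \<open>m = 0\<close> is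
  allowed and contributes \<open>0\<close>, since \<open>0 powr c = 0\<close>.
\<close>

definition representable :: "real \<Rightarrow> nat \<Rightarrow> bool" where
  "representable c n \<longleftrightarrow>
     (\<exists>(m::int) (p::nat). m \<ge> 0 \<and> prime p \<and>
        \<lfloor>real_of_int m powr c\<rfloor> + \<lfloor>real p powr c\<rfloor> = int n)"

definition exceptional_count :: "real \<Rightarrow> real \<Rightarrow> nat" where
  "exceptional_count c x =
     card {n::nat. 0 < n \<and> real n \<le> x \<and> \<not> representable c n}"

end

theory Submission
  imports Defs
begin

text \<open>
  Write \<open>\<gamma> = 1 / c\<close> and \<open>e(t) = exp (2 \<pi> i t)\<close>. If \<open>n\<close> in a dyadic block \<open>[N, 2 N)\<close> is exceptional,
  then for every prime \<open>q\<close> the number \<open>(n - \<lfloor>q\<^sup>c\<rfloor>) powr \<gamma>\<close> avoids modulo 1 an arc of length about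
  \<open>N powr (\<gamma> - 1)\<close>. By a lemma of Montgomery, the number of primes \<open>q\<close> under consideration is then
  bounded by the sum over \<open>1 \<le> h \<le> L\<close>, with \<open>L\<close> about \<open>N powr (1 - \<gamma>)\<close>, of the moduli of
  \<open>\<Sum>\<^sub>q e(h (n - \<lfloor>q\<^sup>c\<rfloor>) powr \<gamma>)\<close>. We square this, sum over all \<open>n\<close> of the block and expand. The
  inner sums over \<open>n\<close> are estimated by the Kusmin--Landau inequality: taking only primes up to
  \<open>N powr (\<gamma> - \<eta>)\<close> keeps the derivative of the phase below \<open>1 / 2\<close>, and the convexity of \<open>q\<^sup>c\<close>
  separates the integers \<open>\<lfloor>q\<^sup>c\<rfloor>\<close>. Apart from a Chebyshev lower bound for the number of primes,
  primality plays no role.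
\<close>

section \<open>The Kusmin--Landau inequality\<close>

text \<open>The function \<open>sin t - t * cos t\<close> vanishes at 0 and has derivative
  \<open>t * sin t\<close>, which is nonnegative up to \<open>pi\<close>. The inequality serves
  twice: for \<open>cot x \<le> 1 / x\<close>, and for a lower bound on \<open>sin \<beta>\<close>
  in Montgomery's lemma.\<close>

lemma x_cos_le_sin:
  fixes x :: real
  assumes "0 \<le> x" "x \<le> pi"
  shows "x * cos x \<le> sin x"
proof -
  have "(\<lambda>t. sin t - t * cos t) 0 \<le> (\<lambda>t. sin t - t * cos t) x"
  proof (rule DERIV_nonneg_imp_nondecreasing[OF assms(1)])
    fix t assume "0 \<le> t" "t \<le> x"
    then show "\<exists>y. ((\<lambda>t. sin t - t * cos t) has_real_derivative y) (at t) \<and> 0 \<le> y"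
      using assms
      by (intro exI[of _ "t * sin t"]) (auto intro!: derivative_eq_intros mult_nonneg_nonneg sin_ge_zero)
  qed
  then show ?thesis by simp
qed

lemma cot_le_inverse:
  fixes x :: real
  assumes "0 < x" "x < pi"
  shows "cot x \<le> 1 / x"
  using x_cos_le_sin[of x] sin_gt_zero[OF assms] assms
  by (simp add: cot_def field_simps)

lemma cot_antimono:
  fixes x y :: real
  assumes "0 < x" "x \<le> y" "y \<le> pi / 2"
  shows "cot y \<le> cot x"
proof -
  have "cos y \<le> cos x" "sin x \<le> sin y" "0 < sin x" "0 \<le> cos y"
    using assms pi_gt_zero by (auto intro!: cos_monotone_0_pi_le sin_monotone_2pi_le sin_gt_zero cos_ge_zero)
  then show ?thesis unfolding cot_def by (intro frac_le) auto
qed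

lemma one_minus_cis_mult:
  assumes "sin x \<noteq> 0"
  shows "(1 - cis (2 * x)) * Complex (1 / 2) (cot x / 2) = 1"
proof -
  have "(1 - cos (2 * x)) / 2 + sin (2 * x) * (cot x / 2) = (sin x)\<^sup>2 + (cos x)\<^sup>2"
    using assms by (simp only: cos_double_sin sin_double cot_def) (simp add: field_simps power2_eq_square)
  moreover have "(1 - cos (2 * x)) * (cot x / 2) = sin (2 * x) / 2"
    using assms by (simp only: cos_double_sin sin_double cot_def) (simp add: field_simps power2_eq_square)
  ultimately show ?thesis by (simp add: complex_eq_iff)
qed

text \<open>Kusmin--Landau: \<open>1 / (1 - e(t)) = 1 / 2 + i cot (\<pi> t) / 2\<close> has monotone imaginary part,
  so partial summation applies to \<open>e(f n) = (e(f n) - e(f (n + 1))) / (1 - e(f (n + 1) - f n))\<close>.\<close>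

lemma kusmin_landau:
  fixes f :: "nat \<Rightarrow> real" and l :: real
  assumes l: "0 < l"
    and lower: "\<And>n. n < M \<Longrightarrow> l \<le> f (Suc n) - f n"
    and upper: "\<And>n. n < M \<Longrightarrow> f (Suc n) - f n \<le> 1 / 2"
    and mono: "\<And>n. Suc n < M \<Longrightarrow> f (Suc (Suc n)) - f (Suc n) \<le> f (Suc n) - f n"
  shows "norm (\<Sum>n<M. cis (2 * pi * f n)) \<le> 1 / l"
proof (cases M)
  case 0
  then show ?thesis using l by simp
next
  case (Suc K)
  define g where "g n = f (Suc n) - f n" for n
  define u where "u n = cot (pi * g n) / 2" for n
  define w where "w n = Complex (1 / 2) (u n)" for n
  define z where "z n = cis (2 * pi * f n)" for n
  have g: "l \<le> g n" "g n \<le> 1 / 2" if "n \<le> K" for n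
    using that lower upper Suc by (auto simp: g_def)
  have u_mono: "u n \<le> u (Suc n)" if "n < K" for n
  proof -
    have "g (Suc n) \<le> g n" using mono[of n] that Suc by (simp add: g_def)
    then have "pi * g (Suc n) \<le> pi * g n" by (simp add: mult_left_mono)
    moreover have "0 < pi * g (Suc n)" using g(1)[of "Suc n"] that l by simp
    moreover have "pi * g n \<le> pi / 2"
      using g(2)[of n] that mult_left_mono[of "g n" "1/2" pi] by simp
    ultimately show ?thesis unfolding u_def using cot_antimono by (intro divide_right_mono) auto
  qed
  have zw: "z n = (z n - z (Suc n)) * w n" if "n \<le> K" for n
  proof -
    have "sin (pi * g n) > 0"
    proof (rule sin_gt_zero)
      show "0 < pi * g n" using g(1)[OF that] l by simp
      show "pi * g n < pi" using mult_strict_left_mono[of "g n" 1 pi] g(2)[OF that] by simp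
    qed
    then have "(1 - cis (2 * (pi * g n))) * w n = 1"
      unfolding w_def u_def by (intro one_minus_cis_mult) simp
    moreover have "z n * (1 - cis (2 * (pi * g n))) = z n - z (Suc n)"
      by (simp add: z_def g_def algebra_simps cis_mult)
    ultimately show ?thesis by (metis mult.assoc mult.right_neutral)
  qed
  have abel: "(\<Sum>n<Suc k. (z n - z (Suc n)) * w n)
      = z 0 * w 0 - z (Suc k) * w k + (\<Sum>n<k. z (Suc n) * (w (Suc n) - w n))" for k
    by (induction k) (simp_all add: algebra_simps)
  have nz: "norm (z n) = 1" for n by (simp add: z_def)
  \<comment> \<open>Consecutive weights differ by a purely imaginary number of constant sign, so the
    total variation of \<open>w\<close> telescopes to \<open>u K - u 0\<close>.\<close>
  have dw: "norm (w (Suc n) - w n) = u (Suc n) - u n" if "n < K" for n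
  proof -
    have "w (Suc n) - w n = Complex 0 (u (Suc n) - u n)" by (simp add: w_def complex_eq_iff)
    then show ?thesis using u_mono[OF that] by (simp add: complex_norm)
  qed
  have u_nonneg: "0 \<le> u n" and u_le: "u n \<le> 1 / (6 * l)" if "n \<le> K" for n
  proof -
    have p: "0 < pi * g n" using g(1)[OF that] l by simp
    have h: "pi * g n \<le> pi / 2"
      using g(2)[OF that] mult_left_mono[of "g n" "1/2" pi] by simp
    have "cot (pi / 2) \<le> cot (pi * g n)" using cot_antimono[OF p h] by simp
    then show "0 \<le> u n" by (simp add: u_def cot_def)
    have "cot (pi * g n) \<le> 1 / (pi * g n)"
      using cot_le_inverse[OF p] h pi_gt_zero by linarith
    also have "\<dots> \<le> 1 / (3 * l)"
      using g(1)[OF that] l pi_gt3 by (intro divide_left_mono mult_mono) auto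
    finally show "u n \<le> 1 / (6 * l)" by (simp add: u_def)
  qed
  have nw: "norm (w n) \<le> 1 / 2 + u n" if "n \<le> K" for n
    using cmod_le[of "w n"] u_nonneg[OF that] by (simp add: w_def)
  have "(\<Sum>n<M. cis (2 * pi * f n)) = (\<Sum>n<Suc K. (z n - z (Suc n)) * w n)"
    unfolding Suc using zw by (intro sum.cong) (auto simp: z_def)
  also have "norm \<dots> \<le> norm (z 0 * w 0 - z (Suc K) * w K)
      + norm (\<Sum>n<K. z (Suc n) * (w (Suc n) - w n))"
    unfolding abel by (rule norm_triangle_ineq)
  also have "norm (z 0 * w 0 - z (Suc K) * w K) \<le> norm (w 0) + norm (w K)"
    using norm_triangle_ineq4[of "z 0 * w 0" "z (Suc K) * w K"] by (simp add: norm_mult nz)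
  also have "norm (\<Sum>n<K. z (Suc n) * (w (Suc n) - w n)) \<le> (\<Sum>n<K. u (Suc n) - u n)"
    by (rule sum_norm_le) (simp add: norm_mult nz dw)
  also have "(\<Sum>n<K. u (Suc n) - u n) = u K - u 0" by (rule sum_lessThan_telescope)
  finally have "norm (\<Sum>n<M. cis (2 * pi * f n)) \<le> 1 + 2 * u K"
    using nw[of 0] nw[of K] by simp
  \<comment> \<open>Since \<open>l \<le> g 0 \<le> 1 / 2\<close>, the constant 1 is at most
    \<open>1 / (2 * l)\<close>; the coefficients then add up to 1/2 + 1/3 < 1.\<close>
  also have "\<dots> \<le> 1 / (2 * l) + 2 * (1 / (6 * l))"
    using u_le[of K] g[of 0] l by (intro add_mono) (auto simp: field_simps)
  also have "\<dots> \<le> 1 / l" using l by (simp add: field_simps)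
  finally show ?thesis .
qed

section \<open>Points avoiding an arc\<close>

text \<open>Each square equals (1 - cos(2 j \<beta>)) / 2, and the cosines over a full period
  \<open>0..L\<close> sum to 0, because \<open>cis (2 * \<beta>)\<close> is an (L + 1)-th root of
  unity; it differs from 1 as \<open>2 \<le> L\<close>. The added term j = 0 contributes nothing to
  the sum of squares.\<close>

lemma sum_sin_squared_equidistant:
  assumes "2 \<le> L"
  shows "(\<Sum>j=1..L. (sin (real j * (pi / real (L + 1))))\<^sup>2) = real (L + 1) / 2"
proof -
  define \<beta> where "\<beta> = pi / real (L + 1)"
  define w where "w = cis (2 * \<beta>)"
  have b: "real (L + 1) * \<beta> = pi" by (simp add: \<beta>_def)
  have "w ^ Suc L = cis (real (Suc L) * (2 * \<beta>))"
    unfolding w_def by (rule Complex.DeMoivre)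
  also have "real (Suc L) * (2 * \<beta>) = 2 * pi"
    using b by simp
  finally have w1: "w ^ Suc L = 1" by simp
  have "0 < 2 * \<beta>" "2 * \<beta> < pi"
    using assms by (simp_all add: \<beta>_def field_simps)
  then have "sin (2 * \<beta>) > 0" by (rule sin_gt_zero)
  then have "w \<noteq> 1" by (auto simp: w_def complex_eq_iff)
  then have "(\<Sum>j<Suc L. w ^ j) = 0"
    using geometric_sum[of w "Suc L"] w1 by simp
  then have "Re (\<Sum>j<Suc L. w ^ j) = 0" by simp
  then have c: "(\<Sum>j<Suc L. cos (2 * (real j * \<beta>))) = 0"
    by (simp add: w_def Complex.DeMoivre mult.left_commute)
  have "(\<Sum>j=1..L. (sin (real j * \<beta>))\<^sup>2) = (\<Sum>j<Suc L. (sin (real j * \<beta>))\<^sup>2)"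
    by (rule sum.mono_neutral_left) (auto simp: less_Suc_eq_le Suc_le_eq)
  also have "\<dots> = (\<Sum>j<Suc L. 1 / 2 - cos (2 * (real j * \<beta>)) / 2)"
    by (intro sum.cong refl) (simp only: cos_double_sin, simp add: field_simps)
  also have "\<dots> = real (L + 1) / 2"
    using c by (simp add: sum_subtractf flip: sum_divide_distrib)
  finally show ?thesis by (simp add: \<beta>_def)
qed

text \<open>The coefficients satisfy sin((j + 1) \<beta>) + sin((j - 1) \<beta>) = 2 cos \<beta>
  sin(j \<beta>). Multiplication by the corresponding quadratic polynomial therefore cancels
  everything except the terms at both ends.\<close>

lemma sine_polynomial_recurrence:
  fixes z :: complex and \<beta> :: real
  shows "(z\<^sup>2 + 1 - 2 * z * of_real (cos \<beta>)) * (\<Sum>j<Suc M. of_real (sin (real j * \<beta>)) * z ^ j)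
    = of_real (sin \<beta>) * z + of_real (sin (real M * \<beta>)) * z ^ (M + 2)
      - of_real (sin (real (M + 1) * \<beta>)) * z ^ (M + 1)"
proof (induction M)
  case 0
  then show ?case by simp
next
  case (Suc M)
  have "sin (real (M + 2) * \<beta>) = sin (real (M + 1) * \<beta> + \<beta>)"
    "sin (real M * \<beta>) = sin (real (M + 1) * \<beta> - \<beta>)"
    by (simp_all add: algebra_simps)
  then have "sin (real (M + 2) * \<beta>) = 2 * cos \<beta> * sin (real (M + 1) * \<beta>) - sin (real M * \<beta>)"
    by (simp add: sin_add sin_diff)
  then have r: "complex_of_real (sin (real (M + 2) * \<beta>))
      = 2 * of_real (cos \<beta>) * of_real (sin (real (M + 1) * \<beta>)) - of_real (sin (real M * \<beta>))"
    by (simp only: of_real_diff of_real_mult of_real_numeral)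
  have "(z\<^sup>2 + 1 - 2 * z * of_real (cos \<beta>)) * (\<Sum>j<Suc (Suc M). of_real (sin (real j * \<beta>)) * z ^ j)
    = (z\<^sup>2 + 1 - 2 * z * of_real (cos \<beta>)) * (\<Sum>j<Suc M. of_real (sin (real j * \<beta>)) * z ^ j)
     + (z\<^sup>2 + 1 - 2 * z * of_real (cos \<beta>)) * (of_real (sin (real (M + 1) * \<beta>)) * z ^ (M + 1))"
    by (simp only: sum.lessThan_Suc[of _ "Suc M"] distrib_left) (simp only: Suc_eq_plus1)
  also have "\<dots> = of_real (sin \<beta>) * z + of_real (sin (real (M + 1) * \<beta>)) * z ^ (M + 3)
      - of_real (sin (real (M + 2) * \<beta>)) * z ^ (M + 2)"
    unfolding Suc.IH r by (simp add: algebra_simps power2_eq_square power3_eq_cube power_add)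
  finally show ?case by (simp add: eval_nat_numeral)
qed

text \<open>Montgomery's lemma. With \<open>\<beta> = \<pi> / (L + 1)\<close> and \<open>K(z) = \<Sum> sin (j \<beta>) z\<^sup>j\<close>,
  the product \<open>(z + 1 / z - 2 cos \<beta>) |K(z)|\<^sup>2\<close> has zero mean and small Fourier coefficients,
  while the hypothesis bounds the first factor above by \<open>2 (cos (2 \<beta>) - cos \<beta>)\<close>.\<close>

lemma card_le_sum_norm_power_sums:
  fixes z :: "'a \<Rightarrow> complex"
  assumes fin: "finite Q" and L: "2 \<le> L"
    and norm1: "\<And>q. q \<in> Q \<Longrightarrow> norm (z q) = 1"
    and avoid: "\<And>q. q \<in> Q \<Longrightarrow> Re (z q) \<le> cos (2 * pi / real (L + 1))"
  shows "real (card Q) \<le> 6 * (\<Sum>h=1..L. norm (\<Sum>q\<in>Q. z q ^ h))"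
proof -
  define \<beta> where "\<beta> = pi / real (L + 1)"
  define a where "a j = sin (real j * \<beta>)" for j
  define S where "S h = (\<Sum>q\<in>Q. z q ^ h)" for h
  define T where "T = (\<Sum>h=1..L. norm (S h))"
  define K where "K q = (\<Sum>j=1..L. of_real (a j) * z q ^ j)" for q
  define E where "E = (\<Sum>q\<in>Q. (norm (K q))\<^sup>2)"
  have b: "real (L + 1) * \<beta> = pi" by (simp add: \<beta>_def)
  have b0: "0 < \<beta>" by (simp add: \<beta>_def)
  have b3: "\<beta> \<le> pi / 3" using L unfolding \<beta>_def by (intro divide_left_mono) auto
  have cos_b: "1 / 2 \<le> cos \<beta>"
    using cos_monotone_0_pi_le[of \<beta> "pi / 3"] b0 b3 by (simp add: cos_60)
  have sin_pos: "0 < sin \<beta>" using b0 b3 by (intro sin_gt_zero) auto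
  have "\<beta> * (1 / 2) \<le> \<beta> * cos \<beta>" using b0 cos_b by (intro mult_left_mono) auto
  also have "\<dots> \<le> sin \<beta>" using b0 b3 by (intro x_cos_le_sin) auto
  finally have "\<beta> \<le> 2 * sin \<beta>" by simp
  moreover have "3 / real (L + 1) \<le> \<beta>"
    unfolding \<beta>_def using pi_gt3 by (intro divide_right_mono) auto
  ultimately have "3 / real (L + 1) \<le> 2 * sin \<beta>" by simp
  then have inv_sin: "1 / sin \<beta> \<le> 2 / 3 * real (L + 1)"
    using sin_pos by (simp add: field_simps)
  have cnj: "z q * cnj (z q) = 1" if "q \<in> Q" for q
    using norm1[OF that] by (simp flip: complex_norm_square)
  have a_abs: "\<bar>a j\<bar> \<le> 1" for j by (simp add: a_def)
  have a_end: "a (L + 1) = 0" unfolding a_def b by simp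
  have a_L: "a L = sin \<beta>"
  proof -
    have "real L * \<beta> = pi - \<beta>" using b by (simp add: algebra_simps)
    then show ?thesis by (simp add: a_def)
  qed
  have pw: "z q ^ j * cnj (z q) ^ k = z q ^ (j - k)" if "q \<in> Q" "k \<le> j" for q j k
  proof -
    have "z q ^ j = z q ^ (j - k) * z q ^ k" using that by (simp flip: power_add)
    then have "z q ^ j * cnj (z q) ^ k = z q ^ (j - k) * (z q * cnj (z q)) ^ k"
      by (simp add: power_mult_distrib)
    then show ?thesis using cnj that by simp
  qed
  \<comment> \<open>On the unit circle \<open>cnj (z q)\<close> is the inverse of
    \<open>z q\<close>, so dividing the recurrence by \<open>z q\<close> turns its quadratic factor
    into twice \<open>Re (z q) - cos \<beta>\<close>. The end values \<open>a (L + 1) = 0\<close>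
    and \<open>a L = sin \<beta>\<close> simplify the right side.\<close>
  have K_eq: "2 * of_real (Re (z q) - cos \<beta>) * K q = of_real (sin \<beta>) * (1 + z q ^ (L + 1))"
    if q: "q \<in> Q" for q
  proof -
    have "K q = (\<Sum>j<Suc L. of_real (sin (real j * \<beta>)) * z q ^ j)"
      unfolding K_def a_def by (rule sum.mono_neutral_left) (auto simp: less_Suc_eq_le Suc_le_eq)
    then have *: "((z q)\<^sup>2 + 1 - 2 * z q * of_real (cos \<beta>)) * K q
        = of_real (sin \<beta>) * z q + of_real (sin \<beta>) * z q ^ (L + 2)"
      using sine_polynomial_recurrence[of "z q" \<beta> L] a_end a_L by (simp add: a_def)
    have "2 * of_real (Re (z q)) = z q + cnj (z q)"
      by (simp add: complex_add_cnj)
    then have "2 * of_real (Re (z q) - cos \<beta>) = z q + cnj (z q) - 2 * of_real (cos \<beta>)"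
      by (simp add: algebra_simps)
    also have "\<dots> = cnj (z q) * ((z q)\<^sup>2 + 1 - 2 * z q * of_real (cos \<beta>))"
      using cnj[OF q] by (simp add: algebra_simps power2_eq_square)
    finally have "2 * of_real (Re (z q) - cos \<beta>) * K q
        = cnj (z q) * (of_real (sin \<beta>) * z q + of_real (sin \<beta>) * z q ^ (L + 2))"
      using * by (simp add: mult.assoc)
    also have "\<dots> = of_real (sin \<beta>) * (z q * cnj (z q)) * (1 + z q ^ (L + 1))"
      by (simp add: algebra_simps)
    finally show ?thesis using cnj[OF q] by simp
  qed
  \<comment> \<open>Multiplying \<open>K_eq\<close> by \<open>cnj (K q)\<close> and summing over
    \<open>q\<close> leaves only the power sums \<open>S h\<close> with
    \<open>1 \<le> h \<le> L\<close>, whence \<open>R \<le> sin \<beta> * T\<close>. The avoidance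
    hypothesis bounds \<open>R\<close> below by \<open>(sin \<beta>)\<^sup>2 * E\<close>, and one
    factor \<open>sin \<beta>\<close> cancels.\<close>
  have upper: "sin \<beta> * E \<le> T"
  proof -
    define R where "R = (\<Sum>q\<in>Q. (cos \<beta> - Re (z q)) * (norm (K q))\<^sup>2)"
    have "complex_of_real (2 * (Re (z q) - cos \<beta>) * (norm (K q))\<^sup>2)
        = of_real (sin \<beta>) * (\<Sum>j=1..L. of_real (a j) * (cnj (z q ^ j) + z q ^ (L + 1 - j)))"
      if q: "q \<in> Q" for q
    proof -
      have "complex_of_real (2 * (Re (z q) - cos \<beta>) * (norm (K q))\<^sup>2)
          = 2 * of_real (Re (z q) - cos \<beta>) * K q * cnj (K q)"
        by (simp only: of_real_mult of_real_numeral complex_norm_square mult.assoc)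
      also have "\<dots> = of_real (sin \<beta>) * ((1 + z q ^ (L + 1)) * cnj (K q))"
        by (simp only: mult.assoc[symmetric] K_eq[OF q])
      also have "(1 + z q ^ (L + 1)) * cnj (K q)
          = (\<Sum>j=1..L. of_real (a j) * (cnj (z q ^ j) + z q ^ (L + 1 - j)))"
        unfolding K_def cnj_sum sum_distrib_left
        using pw[OF q, of _ "L + 1"]
        by (intro sum.cong refl) (simp add: algebra_simps flip: power_Suc)
      finally show ?thesis .
    qed
    then have "complex_of_real (- 2 * R)
        = (\<Sum>q\<in>Q. of_real (sin \<beta>) * (\<Sum>j=1..L. of_real (a j) * (cnj (z q ^ j) + z q ^ (L + 1 - j))))"
      unfolding R_def sum_distrib_left of_real_sum
      by (intro sum.cong refl) (simp add: algebra_simps)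
    also have "\<dots> = of_real (sin \<beta>) * (\<Sum>j=1..L. of_real (a j) * (cnj (S j) + S (L + 1 - j)))"
    proof -
      have "(\<Sum>q\<in>Q. \<Sum>j=1..L. of_real (a j) * (cnj (z q ^ j) + z q ^ (L + 1 - j)))
          = (\<Sum>j=1..L. \<Sum>q\<in>Q. of_real (a j) * (cnj (z q ^ j) + z q ^ (L + 1 - j)))"
        by (rule sum.swap)
      also have "\<dots> = (\<Sum>j=1..L. of_real (a j) * (cnj (S j) + S (L + 1 - j)))"
        by (simp only: S_def cnj_sum sum_distrib_left[symmetric] sum.distrib)
      finally show ?thesis by (simp only: sum_distrib_left[symmetric])
    qed
    finally have "2 * \<bar>R\<bar> = norm (of_real (sin \<beta>) * (\<Sum>j=1..L. of_real (a j) * (cnj (S j) + S (L + 1 - j))))"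
      by (metis abs_mult abs_neg_numeral norm_of_real)
    also have "\<dots> = sin \<beta> * norm (\<Sum>j=1..L. of_real (a j) * (cnj (S j) + S (L + 1 - j)))"
      using sin_pos by (simp add: norm_mult)
    also have "\<dots> \<le> sin \<beta> * (\<Sum>j=1..L. norm (S j) + norm (S (L + 1 - j)))"
    proof (intro mult_left_mono sum_norm_le)
      fix j
      have "norm (of_real (a j) * (cnj (S j) + S (L + 1 - j))) \<le> 1 * norm (cnj (S j) + S (L + 1 - j))"
        unfolding norm_mult norm_of_real by (intro mult_right_mono a_abs) auto
      also have "\<dots> \<le> norm (S j) + norm (S (L + 1 - j))"
        using norm_triangle_ineq[of "cnj (S j)"] by simp
      finally show "norm (of_real (a j) * (cnj (S j) + S (L + 1 - j))) \<le> norm (S j) + norm (S (L + 1 - j))" .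
    qed (use sin_pos in auto)
    also have "(\<Sum>j=1..L. norm (S j) + norm (S (L + 1 - j))) = 2 * T"
      unfolding sum.distrib T_def
      using sum.atLeastAtMost_rev[of "\<lambda>j. norm (S j)" 1 L] by (simp add: add.commute)
    finally have R: "R \<le> sin \<beta> * T" by simp
    have "(sin \<beta>)\<^sup>2 * E \<le> R"
      unfolding E_def R_def sum_distrib_left
    proof (intro sum_mono mult_right_mono)
      fix q assume "q \<in> Q"
      then have "Re (z q) \<le> cos (2 * \<beta>)" using avoid by (simp add: \<beta>_def)
      also have "cos (2 * \<beta>) = 2 * (cos \<beta>)\<^sup>2 - 1" by (rule cos_double_cos)
      finally have "cos \<beta> - Re (z q) \<ge> (1 - cos \<beta>) * (1 + 2 * cos \<beta>)"
        by (simp add: algebra_simps power2_eq_square)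
      moreover have "(1 - cos \<beta>) * (1 + 2 * cos \<beta>) \<ge> (1 - cos \<beta>) * (1 + cos \<beta>)"
        using cos_b by (intro mult_left_mono) auto
      moreover have "(sin \<beta>)\<^sup>2 = (1 - cos \<beta>) * (1 + cos \<beta>)"
        by (simp add: sin_squared_eq algebra_simps power2_eq_square)
      ultimately show "(sin \<beta>)\<^sup>2 \<le> cos \<beta> - Re (z q)" by linarith
    qed auto
    with R have "sin \<beta> * (sin \<beta> * E) \<le> sin \<beta> * T" by (simp add: power2_eq_square mult.assoc)
    then show ?thesis using sin_pos by simp
  qed
  \<comment> \<open>Expanding the squares in \<open>E\<close>, the diagonal yields the main term. An
    off-diagonal entry \<open>D j k\<close> has the modulus of the power sum of order |j - k|; in a
    given row each order occurs at most twice, so the row costs at most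
    \<open>2 * T\<close>.\<close>
  have lower: "real (card Q) * (real (L + 1) / 2) - 2 * real L * T \<le> E"
  proof -
    define D where "D j k = (\<Sum>q\<in>Q. z q ^ j * cnj (z q) ^ k)" for j k
    have D_diag: "D j j = of_nat (card Q)" for j
      using pw by (simp add: D_def)
    have D_less: "norm (D j k) = norm (S (j - k))" if "k < j" for j k
      using pw that by (simp add: D_def S_def)
    have D_cnj: "D j k = cnj (D k j)" for j k
      by (simp add: D_def mult.commute)
    have D_greater: "norm (D j k) = norm (S (k - j))" if "j < k" for j k
      using D_less[OF that] D_cnj[of j k] by simp
    have row: "(\<Sum>k\<in>{1..L} - {j}. norm (D j k)) \<le> 2 * T" if j: "j \<in> {1..L}" for j
    proof -
      have "(\<Sum>k\<in>{1..<j}. norm (S (j - k))) = (\<Sum>h\<in>(\<lambda>k. j - k) ` {1..<j}. norm (S h))"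
        by (subst sum.reindex) (auto simp: inj_on_def)
      also have "\<dots> \<le> T" unfolding T_def using j by (intro sum_mono2) auto
      finally have 1: "(\<Sum>k\<in>{1..<j}. norm (D j k)) \<le> T" by (simp add: D_less)
      have "(\<Sum>k\<in>{j<..L}. norm (S (k - j))) = (\<Sum>h\<in>(\<lambda>k. k - j) ` {j<..L}. norm (S h))"
        by (subst sum.reindex) (auto simp: inj_on_def)
      also have "\<dots> \<le> T" unfolding T_def using j by (intro sum_mono2) auto
      finally have 2: "(\<Sum>k\<in>{j<..L}. norm (D j k)) \<le> T" by (simp add: D_greater)
      have split: "{1..L} - {j} = {1..<j} \<union> {j<..L}" using j by auto
      have "(\<Sum>k\<in>{1..L} - {j}. norm (D j k))
          = (\<Sum>k\<in>{1..<j}. norm (D j k)) + (\<Sum>k\<in>{j<..L}. norm (D j k))"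
        unfolding split by (rule sum.union_disjoint) auto
      then show ?thesis using 1 2 by simp
    qed
    have "complex_of_real E = (\<Sum>q\<in>Q. K q * cnj (K q))"
      unfolding E_def of_real_sum complex_norm_square ..
    also have "\<dots> = (\<Sum>q\<in>Q. \<Sum>j=1..L. \<Sum>k=1..L. of_real (a j * a k) * (z q ^ j * cnj (z q) ^ k))"
      unfolding K_def cnj_sum sum_product by (intro sum.cong refl) simp
    also have "\<dots> = (\<Sum>j=1..L. \<Sum>q\<in>Q. \<Sum>k=1..L. of_real (a j * a k) * (z q ^ j * cnj (z q) ^ k))"
      by (rule sum.swap)
    also have "\<dots> = (\<Sum>j=1..L. \<Sum>k=1..L. of_real (a j * a k) * D j k)"
      unfolding D_def sum_distrib_left by (intro sum.cong refl, rule sum.swap)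
    also have "\<dots> = (\<Sum>j=1..L. of_real ((a j)\<^sup>2 * card Q)
        + (\<Sum>k\<in>{1..L} - {j}. of_real (a j * a k) * D j k))"
      by (intro sum.cong refl, subst sum.remove) (auto simp: D_diag power2_eq_square)
    also have "\<dots> = of_real (card Q * (\<Sum>j=1..L. (a j)\<^sup>2))
        + (\<Sum>j=1..L. \<Sum>k\<in>{1..L} - {j}. of_real (a j * a k) * D j k)"
      by (simp add: sum.distrib sum_distrib_left mult.commute)
    also have "(\<Sum>j=1..L. (a j)\<^sup>2) = real (L + 1) / 2"
      unfolding a_def \<beta>_def by (rule sum_sin_squared_equidistant[OF L])
    finally have "complex_of_real (card Q * (real (L + 1) / 2) - E)
        = - (\<Sum>j=1..L. \<Sum>k\<in>{1..L} - {j}. of_real (a j * a k) * D j k)"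
      by simp
    from arg_cong[OF this, of norm] have "\<bar>card Q * (real (L + 1) / 2) - E\<bar>
        = norm (\<Sum>j=1..L. \<Sum>k\<in>{1..L} - {j}. of_real (a j * a k) * D j k)"
      by (simp only: norm_of_real norm_minus_cancel)
    also have "\<dots> \<le> (\<Sum>j=1..L. \<Sum>k\<in>{1..L} - {j}. norm (D j k))"
    proof (intro sum_norm_le)
      fix j k
      have "\<bar>a j\<bar> * \<bar>a k\<bar> \<le> 1 * 1" by (intro mult_mono a_abs) auto
      then show "norm (of_real (a j * a k) * D j k) \<le> norm (D j k)"
        unfolding norm_mult norm_of_real abs_mult
        using mult_right_mono[of "\<bar>a j\<bar> * \<bar>a k\<bar>" 1 "norm (D j k)"] by simp
    qed
    also have "\<dots> \<le> (\<Sum>j=1..L. 2 * T)" by (intro sum_mono row)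
    also have "\<dots> = 2 * real L * T" by simp
    finally show ?thesis by simp
  qed
  have "E \<le> T * (1 / sin \<beta>)" using upper sin_pos by (simp add: field_simps)
  also have "\<dots> \<le> T * (2 / 3 * real (L + 1))"
    using inv_sin by (intro mult_left_mono) (auto simp: T_def sum_nonneg)
  finally have "real (card Q) * (real (L + 1) / 2) \<le> 2 * real L * T + T * (2 / 3 * real (L + 1))"
    using lower by simp
  \<comment> \<open>The constant 6 comes from 2 + 2/3 \<le> 3 after dividing by (L + 1) / 2.\<close>
  also have "\<dots> \<le> 6 * T * (real (L + 1) / 2)"
    using sum_nonneg[of "{1..L}" "\<lambda>h. norm (S h)"] by (simp add: T_def algebra_simps)
  finally have "real (card Q) \<le> 6 * T"
    by (rule mult_right_le_imp_le) simp
  then show ?thesis by (simp add: T_def S_def)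
qed

section \<open>Chebyshev's lower bound\<close>

text \<open>\<open>m! n! / (m + n + 1)!\<close> is the integral of \<open>x\<^sup>m (1 - x)\<^sup>n\<close> over the unit interval,
  which explains the recurrence behind the induction.\<close>

lemma mult_beta_integral_in_Ints:
  fixes d :: nat
  assumes "\<And>k. 1 \<le> k \<Longrightarrow> k \<le> m + n + 1 \<Longrightarrow> k dvd d"
  shows "real d * fact m * fact n / fact (m + n + 1) \<in> \<int>"
  using assms
proof (induction n arbitrary: m)
  case 0
  from 0[of "m + 1"] obtain e where "d = (m + 1) * e" by auto
  then have d: "real d = real (m + 1) * real e" by (simp only: of_nat_mult)
  have f: "(fact (m + 0 + 1) :: real) = real (m + 1) * fact m"
    using fact_Suc[of m, where 'a = real] by (simp only: Suc_eq_plus1 add_0_right)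
  have "real (m + 1) \<noteq> 0" by linarith
  then have "real d * fact m * fact 0 / fact (m + 0 + 1) = real e"
    unfolding d f by simp
  then show ?case by simp
next
  case (Suc n)
  have "real d * fact m * fact n / fact (m + n + 1) \<in> \<int>"
    using Suc.prems by (intro Suc.IH) auto
  moreover have "real d * fact (m + 1) * fact n / fact (m + 1 + n + 1) \<in> \<int>"
    using Suc.prems by (intro Suc.IH) auto
  moreover have "real d * fact m * fact (Suc n) / fact (m + Suc n + 1)
      = real d * fact m * fact n / fact (m + n + 1) - real d * fact (m + 1) * fact n / fact (m + 1 + n + 1)"
  proof -
    define F where "F = (fact (m + n + 1) :: real)"
    have F: "0 < F" by (simp add: F_def)
    have eqs: "fact (m + Suc n + 1) = (real m + real n + 2) * F"
        "fact (m + 1 + n + 1) = (real m + real n + 2) * F"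
        "fact (m + 1) = (real m + 1) * (fact m :: real)" "fact (Suc n) = (real n + 1) * (fact n :: real)"
      by (simp_all add: F_def algebra_simps)
    have "real m + real n + 2 \<noteq> 0" by linarith
    then show ?thesis
      unfolding eqs F_def[symmetric] using F by (simp add: divide_simps) (simp add: algebra_simps)
  qed
  ultimately show ?case by (metis Ints_diff)
qed

text \<open>Nair's argument: \<open>d\<close> times the integral of (x (1 - x)) to the power n over
  the unit interval is a positive integer, hence at least 1. This gives (2 n + 1) * binomial(2 n, n)
  \<le> d, and the central coefficient is the largest of the 2 n + 1 binomial coefficients that sum
  to \<open>4 ^ n\<close>.\<close>

lemma four_power_le_common_multiple:
  fixes d :: nat
  assumes "0 < d" "\<And>k. 1 \<le> k \<Longrightarrow> k \<le> 2 * n + 1 \<Longrightarrow> k dvd d"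
  shows "4 ^ n \<le> d"
proof -
  define I where "I = real d * fact n * fact n / fact (2 * n + 1)"
  have "I \<in> \<int>"
    unfolding I_def mult_2 using assms(2) by (intro mult_beta_integral_in_Ints) simp
  moreover have "0 < I" using assms(1) by (simp add: I_def)
  ultimately have "1 \<le> I" by (auto elim!: Ints_cases)
  then have "fact (2 * n + 1) \<le> real d * (fact n * fact n)"
    by (simp only: I_def le_divide_eq_1_pos[OF fact_gt_zero] mult.assoc)
  moreover have "(fact (2 * n + 1) :: real) = real (2 * n + 1) * real ((2 * n) choose n) * (fact n * fact n)"
  proof -
    have "fact n * fact n * ((2 * n) choose n) = fact (2 * n)"
      using binomial_fact_lemma[of n "2 * n"] by simp
    then have "(fact (2 * n) :: real) = fact n * fact n * real ((2 * n) choose n)"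
      by (metis of_nat_fact of_nat_mult)
    moreover have "(fact (2 * n + 1) :: real) = real (2 * n + 1) * fact (2 * n)"
      using fact_Suc[of "2 * n", where 'a = real] by (simp only: Suc_eq_plus1)
    ultimately show ?thesis by (simp only: mult_ac)
  qed
  ultimately have "real (2 * n + 1) * real ((2 * n) choose n) \<le> real d"
    by (simp add: mult_le_cancel_right)
  then have d: "(2 * n + 1) * ((2 * n) choose n) \<le> d"
    by (metis of_nat_le_iff of_nat_mult)
  have "4 ^ n = (\<Sum>k\<le>2 * n. (2 * n) choose k)"
    by (simp add: choose_row_sum power_mult)
  also have "\<dots> \<le> (\<Sum>k\<le>2 * n. (2 * n) choose n)"
    using binomial_maximum'[of n] by (intro sum_mono) auto
  also have "\<dots> \<le> d" using d by simp
  finally show ?thesis .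
qed

text \<open>The witness is the least common multiple of 1, ..., N, written as the product over
  primes of the largest power not exceeding \<open>N\<close>. Each factor is at most
  \<open>N\<close>, and there is one factor per prime.\<close>

lemma common_multiple_le_power_prime_count:
  "\<exists>d>0. (\<forall>k. 1 \<le> k \<and> k \<le> N \<longrightarrow> k dvd d) \<and> d \<le> N ^ card {p. prime p \<and> p \<le> (N::nat)}"
proof (cases "N = 0")
  case True
  have "{p. prime p \<and> p \<le> (0::nat)} = {}" by auto
  then have "card {p. prime p \<and> p \<le> (0::nat)} = 0" by (simp only: card.empty)
  \<comment> \<open>For \<open>N = 0\<close> the bound is \<open>0 ^ 0 = 1\<close>, which admits the
    witness 1.\<close>
  then have "1 \<le> (0::nat) ^ card {p. prime p \<and> p \<le> (0::nat)}" by (simp only: power_0)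
  then show ?thesis unfolding True by (intro exI[of _ 1]) (simp only:, simp)
next
  case False
  define P where "P = {p. prime p \<and> p \<le> N}"
  define e where "e p = (GREATEST e. p ^ e \<le> N)" for p
  have fin: "finite P" by (simp add: P_def)
  have bound: "e' \<le> N" if "p \<in> P" "p ^ e' \<le> N" for p e'
  proof -
    have "2 ^ e' \<le> p ^ e'" using that by (intro power_mono) (auto simp: P_def prime_ge_2_nat)
    then show ?thesis using that less_exp[of e'] by linarith
  qed
  have e: "p ^ e p \<le> N" if "p \<in> P" for p
    unfolding e_def
    by (rule GreatestI_nat[where P = "\<lambda>e. p ^ e \<le> N" and k = 0 and b = N])
      (use bound[OF that] False in auto)
  have e_max: "e' \<le> e p" if "p \<in> P" "p ^ e' \<le> N" for p e'
    unfolding e_def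
    by (rule Greatest_le_nat[where P = "\<lambda>e. p ^ e \<le> N" and b = N])
      (use bound[OF that(1)] that(2) in auto)
  define d where "d = (\<Prod>p\<in>P. p ^ e p)"
  have "0 < d" unfolding d_def by (intro prod_pos) (auto simp: P_def prime_gt_0_nat)
  moreover have "k dvd d" if k: "1 \<le> k" "k \<le> N" for k
  proof -
    have sub: "prime_factors k \<subseteq> P"
      using k by (auto simp: P_def prime_factors_dvd dest: dvd_imp_le)
    have "k = (\<Prod>p\<in>prime_factors k. p ^ multiplicity p k)"
      using k by (intro prime_factorization_nat) auto
    also have "\<dots> dvd (\<Prod>p\<in>prime_factors k. p ^ e p)"
    proof (intro prod_dvd_prod le_imp_power_dvd)
      fix p assume p: "p \<in> prime_factors k"
      have "p ^ multiplicity p k \<le> k" using k by (intro dvd_imp_le multiplicity_dvd) auto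
      then show "multiplicity p k \<le> e p" using k sub p by (intro e_max) auto
    qed
    also have "\<dots> dvd d" unfolding d_def by (rule prod_dvd_prod_subset[OF fin sub])
    finally show ?thesis .
  qed
  moreover have "d \<le> N ^ card P"
    unfolding d_def using e by (intro prod_le_power) (use False in auto)
  ultimately show ?thesis by (auto simp: P_def)
qed

text \<open>For the largest odd N = 2 n + 1 not exceeding \<open>x\<close>, the two bounds on a
  common multiple of 1, ..., N are compared and logarithms taken. The claim follows from
  \<open>1 \<le> ln 4\<close> and n > (x - 3) / 2.\<close>

lemma chebyshev_lower_bound:
  fixes x :: real
  assumes x: "3 \<le> x"
  shows "(x - 3) / 2 \<le> real (card {p. prime p \<and> real p \<le> x}) * ln x"
proof -
  define n where "n = nat \<lfloor>(x - 1) / 2\<rfloor>"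
  define N where "N = 2 * n + 1"
  have fl: "real n = of_int \<lfloor>(x - 1) / 2\<rfloor>" using x by (simp add: n_def)
  have n_le: "real n \<le> (x - 1) / 2" and n_ge: "(x - 1) / 2 < real n + 1"
    unfolding fl by linarith+
  have Nx: "real N \<le> x" using n_le by (simp add: N_def)
  have N1: "1 \<le> real N" by (simp add: N_def)
  obtain d where d: "0 < d" "\<And>k. 1 \<le> k \<Longrightarrow> k \<le> N \<Longrightarrow> k dvd d"
      "d \<le> N ^ card {p. prime p \<and> p \<le> N}"
    using common_multiple_le_power_prime_count[of N] by auto
  have "4 ^ n \<le> d" using d unfolding N_def by (intro four_power_le_common_multiple) auto
  then have "real (4 ^ n) \<le> real (N ^ card {p. prime p \<and> p \<le> N})"
    using d(3) by (intro of_nat_mono) (rule order_trans)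
  then have "(4::real) ^ n \<le> real N ^ card {p. prime p \<and> p \<le> N}"
    by (simp only: of_nat_power of_nat_numeral)
  then have "ln ((4::real) ^ n) \<le> ln (real N ^ card {p. prime p \<and> p \<le> N})"
    by (subst ln_le_cancel_iff) (use N1 in auto)
  then have "real n * ln 4 \<le> real (card {p. prime p \<and> p \<le> N}) * ln (real N)"
    using N1 by (simp add: ln_realpow)
  also have "\<dots> \<le> real (card {p. prime p \<and> real p \<le> x}) * ln x"
  proof (intro mult_mono)
    have "finite {p. prime p \<and> real p \<le> x}"
      by (rule finite_subset[of _ "{..nat \<lfloor>x\<rfloor>}"]) (auto simp: le_nat_floor)
    then show "real (card {p. prime p \<and> p \<le> N}) \<le> real (card {p. prime p \<and> real p \<le> x})"
      using Nx by (intro of_nat_mono card_mono) auto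
  qed (use Nx N1 x in auto)
  finally have *: "real n * ln 4 \<le> real (card {p. prime p \<and> real p \<le> x}) * ln x" .
  have "1 \<le> ln (4::real)" using exp_le by (subst ln_ge_iff) auto
  then have "real n * 1 \<le> real n * ln 4" by (intro mult_left_mono) auto
  with * n_ge show ?thesis by simp
qed

section \<open>Mean squares of exponential sums\<close>

lemma powr_difference_mvt:
  fixes r s t :: real
  assumes "0 < s" "s < t"
  obtains \<zeta> where "s < \<zeta>" "\<zeta> < t" "t powr r - s powr r = (t - s) * (r * \<zeta> powr (r - 1))"
proof -
  have "\<exists>\<zeta>>s. \<zeta> < t \<and> t powr r - s powr r = (t - s) * (r * \<zeta> powr (r - 1))"
  proof (rule MVT2[OF assms(2)])
    fix x assume "s \<le> x" "x \<le> t"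
    then show "((\<lambda>y. y powr r) has_real_derivative r * x powr (r - 1)) (at x)"
      using assms by (intro has_real_derivative_powr) auto
  qed
  then show ?thesis using that by blast
qed

text \<open>The derivative \<open>D\<close> of the phase is a difference of two values of a power
  function, so by the mean value theorem it equals h g (1 - g) (a - b) times a (g - 2)-th power of a
  point between N / 2 and 2 N. It is thus positive, of controlled size and nonincreasing, as
  Kusmin--Landau requires; \<open>small\<close> keeps it at most 1/2.\<close>

lemma norm_sum_cis_powr_difference_le:
  fixes a b g h :: real and N :: nat
  assumes g: "0 < g" "g < 1" and h: "0 < h" and ab: "0 \<le> b" "b < a" "a \<le> real N / 2" and N: "0 < N"
    and small: "h * g * (1 - g) * (a - b) * (real N / 2) powr (g - 2) \<le> 1 / 2"
  shows "norm (\<Sum>j<N. cis (2 * pi * (h * ((real (N + j) - a) powr g - (real (N + j) - b) powr g))))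
    \<le> 1 / (h * g * (1 - g) * (a - b) * (2 * real N) powr (g - 2))"
proof -
  define \<phi> where "\<phi> t = h * ((t - a) powr g - (t - b) powr g)" for t
  define D where "D t = h * g * ((t - a) powr (g - 1) - (t - b) powr (g - 1))" for t
  have step: "\<exists>\<xi>. real (N + j) < \<xi> \<and> \<xi> < real (N + Suc j)
      \<and> \<phi> (real (N + Suc j)) - \<phi> (real (N + j)) = D \<xi>" for j
  proof -
    have "\<exists>\<xi>>real (N + j). \<xi> < real (N + Suc j)
        \<and> \<phi> (real (N + Suc j)) - \<phi> (real (N + j)) = (real (N + Suc j) - real (N + j)) * D \<xi>"
    proof (rule MVT2)
      fix x assume "real (N + j) \<le> x"
      then show "(\<phi> has_real_derivative D x) (at x)"
        unfolding \<phi>_def D_def using ab N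
        by (auto intro!: derivative_eq_intros simp: algebra_simps)
    qed simp
    then show ?thesis by auto
  qed
  have bounds: "h * g * (1 - g) * (a - b) * (2 * real N) powr (g - 2) \<le> D t"
      "D t \<le> h * g * (1 - g) * (a - b) * (real N / 2) powr (g - 2)"
    if t: "real N \<le> t" "t \<le> 2 * real N" for t
  proof -
    have "0 < t - a" "t - a < t - b" using ab N t by auto
    then obtain \<zeta> where z: "t - a < \<zeta>" "\<zeta> < t - b"
      "(t - b) powr (g - 1) - (t - a) powr (g - 1) = ((t - b) - (t - a)) * ((g - 1) * \<zeta> powr (g - 1 - 1))"
      by (rule powr_difference_mvt)
    have D: "D t = h * g * (1 - g) * (a - b) * \<zeta> powr (g - 2)"
    proof -
      have "(t - a) powr (g - 1) - (t - b) powr (g - 1) = (1 - g) * (a - b) * \<zeta> powr (g - 2)"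
        using z(3) by (simp add: algebra_simps)
      then show ?thesis by (simp add: D_def mult.assoc)
    qed
    have pos: "0 \<le> h * g * (1 - g) * (a - b)" using g h ab by auto
    show "h * g * (1 - g) * (a - b) * (2 * real N) powr (g - 2) \<le> D t"
      unfolding D using z ab N t g by (intro mult_left_mono[OF _ pos] powr_mono2') auto
    show "D t \<le> h * g * (1 - g) * (a - b) * (real N / 2) powr (g - 2)"
      unfolding D using z ab N t g by (intro mult_left_mono[OF _ pos] powr_mono2') auto
  qed
  have D_mono: "D t \<le> D s" if "real N \<le> s" "s \<le> t" for s t
  proof (rule DERIV_nonpos_imp_nonincreasing[OF that(2)])
    fix x assume "s \<le> x" "x \<le> t"
    then have x: "0 < x - a" "x - a < x - b" using ab N that by auto
    have "(x - b) powr (g - 2) \<le> (x - a) powr (g - 2)"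
      using x g by (intro powr_mono2') auto
    then have "h * g * ((g - 1) * ((x - a) powr (g - 2) - (x - b) powr (g - 2))) \<le> 0"
      using g h by (intro mult_nonneg_nonpos mult_nonpos_nonneg) auto
    moreover have "(D has_real_derivative h * g * ((g - 1) * ((x - a) powr (g - 2) - (x - b) powr (g - 2)))) (at x)"
      unfolding D_def using x by (auto intro!: derivative_eq_intros simp: algebra_simps)
    ultimately show "\<exists>y. (D has_real_derivative y) (at x) \<and> y \<le> 0" by blast
  qed
  have "norm (\<Sum>j<N. cis (2 * pi * \<phi> (real (N + j))))
      \<le> 1 / (h * g * (1 - g) * (a - b) * (2 * real N) powr (g - 2))"
  proof (rule kusmin_landau)
    show "0 < h * g * (1 - g) * (a - b) * (2 * real N) powr (g - 2)" using g h ab N by simp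
  next
    fix j assume j: "j < N"
    obtain \<xi> where \<xi>: "real (N + j) < \<xi>" "\<xi> < real (N + Suc j)"
        "\<phi> (real (N + Suc j)) - \<phi> (real (N + j)) = D \<xi>" using step by blast
    have "real N \<le> \<xi>" "\<xi> \<le> 2 * real N" using \<xi> j by auto
    then show "h * g * (1 - g) * (a - b) * (2 * real N) powr (g - 2) \<le> \<phi> (real (N + Suc j)) - \<phi> (real (N + j))"
      "\<phi> (real (N + Suc j)) - \<phi> (real (N + j)) \<le> 1 / 2"
      using \<xi>(3) small bounds[of \<xi>] by auto
  next
    fix j assume "Suc j < N"
    obtain \<xi> where \<xi>: "real (N + j) < \<xi>" "\<xi> < real (N + Suc j)"
        "\<phi> (real (N + Suc j)) - \<phi> (real (N + j)) = D \<xi>" using step by blast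
    obtain \<xi>' where \<xi>': "real (N + Suc j) < \<xi>'"
        "\<phi> (real (N + Suc (Suc j))) - \<phi> (real (N + Suc j)) = D \<xi>'" using step by blast
    show "\<phi> (real (N + Suc (Suc j))) - \<phi> (real (N + Suc j)) \<le> \<phi> (real (N + Suc j)) - \<phi> (real (N + j))"
      unfolding \<xi>(3) \<xi>'(2) using \<xi> \<xi>'(1) by (intro D_mono) auto
  qed
  then show ?thesis by (simp add: \<phi>_def)
qed

lemma harm_le_one_plus_ln:
  assumes "0 < n"
  shows "harm n \<le> 1 + ln (real n)"
  using euler_mascheroni_sequence_decreasing[of 1 n] assms by (simp add: harm_def)

text \<open>On each side of \<open>q\<close> the distances are distinct integers in
  \<open>{1..X}\<close>, so each side contributes at most a harmonic sum.\<close>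

lemma sum_inverse_distance_le:
  fixes Q :: "nat set"
  assumes Q: "Q \<subseteq> {1..X}" and q: "q \<in> Q"
  shows "(\<Sum>r\<in>Q - {q}. 1 / \<bar>real q - real r\<bar>) \<le> 2 * (1 + ln (real X))"
proof -
  have X: "1 \<le> q" "q \<le> X" using Q q by auto
  have "(\<Sum>r\<in>{1..<q}. 1 / real (q - r)) = (\<Sum>k\<in>(\<lambda>r. q - r) ` {1..<q}. 1 / real k)"
    by (subst sum.reindex) (auto simp: inj_on_def)
  also have "\<dots> \<le> (\<Sum>k=1..X. 1 / real k)" using X by (intro sum_mono2) auto
  also have "\<dots> = harm X" by (simp add: harm_def inverse_eq_divide)
  finally have 1: "(\<Sum>r\<in>{1..<q}. 1 / \<bar>real q - real r\<bar>) \<le> harm X" by (simp add: of_nat_diff)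
  have "(\<Sum>r\<in>{q<..X}. 1 / real (r - q)) = (\<Sum>k\<in>(\<lambda>r. r - q) ` {q<..X}. 1 / real k)"
    by (subst sum.reindex) (auto simp: inj_on_def)
  also have "\<dots> \<le> (\<Sum>k=1..X. 1 / real k)" using X by (intro sum_mono2) auto
  also have "\<dots> = harm X" by (simp add: harm_def inverse_eq_divide)
  finally have 2: "(\<Sum>r\<in>{q<..X}. 1 / \<bar>real q - real r\<bar>) \<le> harm X" by (simp add: of_nat_diff)
  have "(\<Sum>r\<in>Q - {q}. 1 / \<bar>real q - real r\<bar>) \<le> (\<Sum>r\<in>{1..<q} \<union> {q<..X}. 1 / \<bar>real q - real r\<bar>)"
    using Q by (intro sum_mono2) auto
  also have "\<dots> = (\<Sum>r\<in>{1..<q}. 1 / \<bar>real q - real r\<bar>) + (\<Sum>r\<in>{q<..X}. 1 / \<bar>real q - real r\<bar>)"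
    by (intro sum.union_disjoint) auto
  also have "\<dots> \<le> 2 * harm X" using 1 2 by simp
  also have "\<dots> \<le> 2 * (1 + ln (real X))" using harm_le_one_plus_ln[of X] X by simp
  finally show ?thesis .
qed

text \<open>After expanding the square, the sum over \<open>j\<close> is carried out first. The pair
  (q, q) gives \<open>N\<close>; a pair with q and r distinct gives a Kusmin--Landau sum bounded by
  a constant over |a q - a r|, and the spacing condition reduces the sum over r to one of inverse
  distances.\<close>

lemma mean_square_exponential_sum_le:
  fixes a :: "nat \<Rightarrow> real" and g h s R :: real
  assumes g: "0 < g" "g < 1" and h: "0 < h" and N: "0 < N" and s: "0 < s"
    and Q: "Q \<subseteq> {1..X}"
    and a: "\<And>q. q \<in> Q \<Longrightarrow> 0 \<le> a q" "\<And>q. q \<in> Q \<Longrightarrow> a q \<le> R" and R: "R \<le> real N / 2"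
    and spacing: "\<And>q r. q \<in> Q \<Longrightarrow> r \<in> Q \<Longrightarrow> r < q \<Longrightarrow> s * (real q - real r) \<le> a q - a r"
    and small: "h * g * (1 - g) * R * (real N / 2) powr (g - 2) \<le> 1 / 2"
  shows "(\<Sum>j<N. (norm (\<Sum>q\<in>Q. cis (2 * pi * (h * (real (N + j) - a q) powr g))))\<^sup>2)
    \<le> card Q * (N + 2 * (1 + ln X) / (h * g * (1 - g) * s * (2 * real N) powr (g - 2)))"
proof -
  define z where "z q j = cis (2 * pi * (h * (real (N + j) - a q) powr g))" for q j
  define D where "D q r = (\<Sum>j<N. z q j * cnj (z r j))" for q r
  define B where "B = h * g * (1 - g) * (2 * real N) powr (g - 2)"
  have fin: "finite Q" using Q by (rule finite_subset) simp
  have B: "0 < B" using g h N by (simp add: B_def)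
  have D_diag: "D q q = of_nat N" for q
    by (simp add: D_def z_def cis_cnj cis_mult)
  have D_less: "norm (D q r) \<le> 1 / (B * s) * (1 / \<bar>real q - real r\<bar>)"
    if qr: "q \<in> Q" "r \<in> Q" "r < q" for q r
  proof -
    have sp: "s * (real q - real r) \<le> a q - a r" using spacing qr by simp
    have sp0: "0 < s * (real q - real r)" using s qr by simp
    have "D q r = (\<Sum>j<N. cis (2 * pi * (h * ((real (N + j) - a q) powr g - (real (N + j) - a r) powr g))))"
      unfolding D_def z_def by (simp add: cis_cnj cis_mult algebra_simps)
    also have "norm \<dots> \<le> 1 / (h * g * (1 - g) * (a q - a r) * (2 * real N) powr (g - 2))"
    proof (rule norm_sum_cis_powr_difference_le[OF g h])
      show "0 \<le> a r" "a r < a q" "a q \<le> real N / 2" "0 < N"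
        using a qr R N sp sp0 by (force intro: order_trans)+
      \<comment> \<open>As \<open>a r\<close> is nonnegative, every difference is at most
        \<open>R\<close>, so one smallness condition covers all pairs.\<close>
      have "h * g * (1 - g) * (a q - a r) * (real N / 2) powr (g - 2) \<le> h * g * (1 - g) * R * (real N / 2) powr (g - 2)"
        using a qr g h by (intro mult_right_mono mult_left_mono) (auto intro: order_trans[of _ "a q"])
      then show "h * g * (1 - g) * (a q - a r) * (real N / 2) powr (g - 2) \<le> 1 / 2"
        using small by linarith
    qed
    also have "\<dots> = 1 / (B * (a q - a r))" by (simp add: B_def mult_ac)
    also have "\<dots> \<le> 1 / (B * (s * (real q - real r)))"
      using sp B s qr less_le_trans[OF sp0 sp] by (intro divide_left_mono mult_left_mono mult_pos_pos) auto
    finally show ?thesis using qr by (simp add: mult_ac)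
  qed
  have D_cnj: "D q r = cnj (D r q)" for q r
    by (simp add: D_def mult.commute)
  have D_off: "norm (D q r) \<le> 1 / (B * s) * (1 / \<bar>real q - real r\<bar>)"
    if qr: "q \<in> Q" "r \<in> Q - {q}" for q r
  proof (cases "r < q")
    case True
    then show ?thesis using D_less qr by simp
  next
    case False
    then show ?thesis using D_less[of r q] D_cnj[of q r] qr by (simp add: abs_minus_commute)
  qed
  have row: "norm (\<Sum>r\<in>Q. D q r) \<le> N + 2 * (1 + ln X) / (B * s)" if q: "q \<in> Q" for q
  proof -
    have "(\<Sum>r\<in>Q. D q r) = of_nat N + (\<Sum>r\<in>Q - {q}. D q r)"
      using fin q by (simp add: sum.remove D_diag)
    also have "norm \<dots> \<le> N + norm (\<Sum>r\<in>Q - {q}. D q r)"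
      using norm_triangle_ineq[of "of_nat N :: complex"] by simp
    also have "norm (\<Sum>r\<in>Q - {q}. D q r) \<le> (\<Sum>r\<in>Q - {q}. 1 / (B * s) * (1 / \<bar>real q - real r\<bar>))"
      by (intro sum_norm_le D_off q)
    also have "\<dots> = 1 / (B * s) * (\<Sum>r\<in>Q - {q}. 1 / \<bar>real q - real r\<bar>)"
      by (simp only: sum_distrib_left)
    also have "\<dots> \<le> 1 / (B * s) * (2 * (1 + ln X))"
      using B s by (intro mult_left_mono sum_inverse_distance_le Q q) auto
    finally show ?thesis by simp
  qed
  have "complex_of_real (\<Sum>j<N. (norm (\<Sum>q\<in>Q. z q j))\<^sup>2) = (\<Sum>j<N. \<Sum>q\<in>Q. \<Sum>r\<in>Q. z q j * cnj (z r j))"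
    unfolding of_real_sum complex_norm_square cnj_sum sum_product ..
  also have "\<dots> = (\<Sum>q\<in>Q. \<Sum>j<N. \<Sum>r\<in>Q. z q j * cnj (z r j))"
    by (rule sum.swap)
  also have "\<dots> = (\<Sum>q\<in>Q. \<Sum>r\<in>Q. D q r)"
    unfolding D_def by (rule sum.cong[OF refl], rule sum.swap)
  finally have "\<bar>\<Sum>j<N. (norm (\<Sum>q\<in>Q. z q j))\<^sup>2\<bar> = norm (\<Sum>q\<in>Q. \<Sum>r\<in>Q. D q r)"
    by (metis norm_of_real)
  also have "\<dots> \<le> (\<Sum>q\<in>Q. N + 2 * (1 + ln X) / (B * s))"
    by (intro sum_norm_le row)
  also have "\<dots> = card Q * (N + 2 * (1 + ln X) / (B * s))" by simp
  finally have "(\<Sum>j<N. (norm (\<Sum>q\<in>Q. z q j))\<^sup>2) \<le> card Q * (N + 2 * (1 + ln X) / (B * s))" by simp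
  moreover have "B * s = h * g * (1 - g) * s * (2 * real N) powr (g - 2)" by (simp add: B_def mult_ac)
  ultimately show ?thesis by (simp only: z_def)
qed

section \<open>Exceptional integers in a dyadic block\<close>

text \<open>The value cos(2 pi t) is a decreasing function of the distance from \<open>t\<close> to
  the nearest integer, so \<open>round t\<close> is the required integer.\<close>

lemma near_integer_if_cos_gt:
  fixes t d :: real
  assumes "0 \<le> d" "d \<le> 1 / 2" "cos (2 * pi * d) < cos (2 * pi * t)"
  obtains m :: int where "\<bar>t - m\<bar> < d"
proof -
  define m where "m = round t"
  have "\<bar>t - m\<bar> < d"
  proof (rule ccontr)
    assume "\<not> \<bar>t - m\<bar> < d"
    then have "2 * pi * d \<le> 2 * pi * \<bar>t - m\<bar>" by (intro mult_left_mono) auto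
    moreover have "\<bar>t - m\<bar> \<le> 1 / 2"
      using of_int_round_abs_le[of t] by (simp add: m_def abs_minus_commute)
    then have "2 * pi * \<bar>t - m\<bar> \<le> 2 * pi * (1 / 2)" by (intro mult_left_mono) auto
    ultimately have "cos (2 * pi * \<bar>t - m\<bar>) \<le> cos (2 * pi * d)"
      using assms(1) by (intro cos_monotone_0_pi_le) auto
    moreover have "cos (2 * pi * \<bar>t - m\<bar>) = cos (2 * pi * t)"
    proof -
      have "2 * pi * \<bar>t - m\<bar> = \<bar>2 * pi * (t - m)\<bar>" by (simp add: abs_mult)
      then have "cos (2 * pi * \<bar>t - m\<bar>) = cos (2 * pi * (t - m))" by (simp only: cos_abs_real)
      also have "\<dots> = cos (2 * pi * t - 2 * pi * m)" by (simp add: algebra_simps)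
      also have "\<dots> = cos (2 * pi * t)" by (simp add: cos_diff)
      finally show ?thesis .
    qed
    ultimately show False using assms(3) by linarith
  qed
  then show ?thesis by (rule that)
qed

lemma powr_successor_gap:
  fixes t u g :: real
  assumes "0 < t" "t + 1 \<le> u" "0 < g" "g < 1"
  shows "g * u powr (g - 1) \<le> (t + 1) powr g - t powr g"
proof -
  obtain \<zeta> where z: "t < \<zeta>" "\<zeta> < t + 1"
    "(t + 1) powr g - t powr g = (t + 1 - t) * (g * \<zeta> powr (g - 1))"
    using powr_difference_mvt[of t "t + 1" g] assms by auto
  have "u powr (g - 1) \<le> \<zeta> powr (g - 1)"
    using z assms by (intro powr_mono2') auto
  then show ?thesis using z(3) assms by simp
qed

text \<open>The value \<open>k\<close> has the form \<open>\<lfloor>m\<^sup>c\<rfloor>\<close> as soon as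
  an integer lies between \<open>k powr (1 / c)\<close> and \<open>(k + 1) powr (1 / c)\<close>.\<close>

lemma representable_if_cos_gt:
  fixes c :: real and n N q L :: nat
  assumes c: "1 < c" and q: "prime q" and qN: "q powr c \<le> real N / 2"
    and n: "N \<le> n" "n < 2 * N" and L: "1 \<le> L"
    and gap: "2 / real (L + 1) \<le> 1 / c * (2 * real N) powr (1 / c - 1)"
    and gt: "cos (2 * pi * (1 / real (L + 1)))
      < cos (2 * pi * ((n - \<lfloor>q powr c\<rfloor>) powr (1 / c) + 1 / real (L + 1)))"
  shows "representable c n"
proof -
  define t where "t = real n - \<lfloor>q powr c\<rfloor>"
  define \<theta> where "\<theta> = t powr (1 / c)"
  have "0 \<le> \<lfloor>q powr c\<rfloor>" "real n + 1 \<le> 2 * real N" "1 \<le> real n"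
    using n by auto
  then have t: "0 < t" "t + 1 \<le> 2 * real N"
    using qN n unfolding t_def by linarith+
  have inv: "(x powr (1 / c)) powr c = x" if "0 < x" for x :: real
    using that c by (simp add: powr_powr)
  \<comment> \<open>The shift by 1 / (L + 1) centres the arc: an integer within 1 / (L + 1) of the
    shifted point lies strictly between \<open>\<theta>\<close> and
    \<open>\<theta> + 2 / (L + 1)\<close>, and \<open>gap\<close> keeps this interval below
    \<open>(t + 1) powr (1 / c)\<close>.\<close>
  obtain m :: int where "\<bar>\<theta> + 1 / real (L + 1) - m\<bar> < 1 / real (L + 1)"
  proof (rule near_integer_if_cos_gt)
    show "1 / real (L + 1) \<le> 1 / 2" using L by (simp add: field_simps)
  qed (use gt in \<open>auto simp: \<theta>_def t_def\<close>)
  then have m: "\<theta> < m" "m < \<theta> + 2 / real (L + 1)" by (auto simp: abs_if split: if_splits)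
  have "2 / real (L + 1) \<le> (t + 1) powr (1 / c) - \<theta>"
    using powr_successor_gap[of t "2 * N" "1 / c"] t c gap by (simp add: \<theta>_def)
  then have m2: "m < (t + 1) powr (1 / c)" using m by linarith
  have m0: "0 < m" using m(1) t unfolding \<theta>_def by (metis less_trans of_int_0_less_iff powr_gt_zero less_irrefl)
  have "t < m powr c"
    using powr_less_mono2[of c \<theta> m] m(1) c inv[OF t(1)] by (simp add: \<theta>_def)
  moreover have "m powr c < t + 1"
    using powr_less_mono2[of c m "(t + 1) powr (1 / c)"] m2 m0 c inv[of "t + 1"] t by simp
  moreover have "t = real_of_int (int n - \<lfloor>q powr c\<rfloor>)" by (simp add: t_def)
  ultimately have "\<lfloor>m powr c\<rfloor> = int n - \<lfloor>q powr c\<rfloor>"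
    by (intro floor_unique) auto
  then show ?thesis
    unfolding representable_def using m0 q by (intro exI[of _ m] exI[of _ q]) auto
qed

text \<open>By the mean value theorem the unrounded powers differ by at least (q - r) times
  \<open>Y powr (c - 1)\<close>, hence by at least 2. Rounding loses at most 1, which is at most
  half of that.\<close>

lemma floor_powr_spacing:
  fixes c Y :: real and q r :: nat
  assumes c: "1 < c" and Y: "2 \<le> Y powr (c - 1)" "0 < Y" and r: "Y \<le> r" "r < q"
  shows "Y powr (c - 1) / 2 * (real q - real r) \<le> of_int \<lfloor>q powr c\<rfloor> - of_int \<lfloor>r powr c\<rfloor>"
proof -
  have r0: "0 < real r" "real r < real q" using Y r by auto
  obtain \<zeta> where z: "real r < \<zeta>" "\<zeta> < real q"
    "q powr c - r powr c = (real q - real r) * (c * \<zeta> powr (c - 1))"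
    by (rule powr_difference_mvt[OF r0])
  have "Y powr (c - 1) \<le> \<zeta> powr (c - 1)" using z r Y c by (intro powr_mono2) auto
  also have "\<dots> \<le> c * \<zeta> powr (c - 1)"
    using mult_right_mono[of 1 c "\<zeta> powr (c - 1)"] c by simp
  finally have "(real q - real r) * Y powr (c - 1) \<le> q powr c - r powr c"
    unfolding z(3) using r0 by (intro mult_left_mono) auto
  moreover have "1 * 2 \<le> (real q - real r) * Y powr (c - 1)"
    using r Y by (intro mult_mono) auto
  moreover have "q powr c - r powr c - 1 \<le> of_int \<lfloor>q powr c\<rfloor> - of_int \<lfloor>r powr c\<rfloor>" by linarith
  moreover have "Y powr (c - 1) / 2 * (real q - real r) = (real q - real r) * Y powr (c - 1) / 2" by simp
  ultimately show ?thesis by linarith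
qed

text \<open>For exceptional \<open>n\<close> no prime in \<open>Q\<close> satisfies the cosine
  inequality, so Montgomery's lemma bounds \<open>card Q\<close> by exponential sums.
  Cauchy--Schwarz over \<open>h\<close> and the mean square bound over \<open>n\<close> then control
  \<open>card A\<close> times the square of \<open>card Q\<close>, and one factor
  \<open>card Q\<close> cancels.\<close>

lemma card_exceptional_mult_card_primes_le:
  fixes c g X Y :: real and N L :: nat and Q :: "nat set"
  assumes c: "1 < c" and g_def: "g = 1 / c" and N: "0 < N" and L: "2 \<le> L"
    and Q: "\<And>q. q \<in> Q \<Longrightarrow> prime q \<and> Y \<le> real q \<and> real q \<le> X"
    and Y: "0 < Y" "2 \<le> Y powr (c - 1)" and X: "1 \<le> X" "X powr c \<le> real N / 2"
    and gap: "2 / real (L + 1) \<le> g * (2 * real N) powr (g - 1)"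
    and small: "L * g * (1 - g) * X powr c * (real N / 2) powr (g - 2) \<le> 1 / 2"
  shows "real (card {n. N \<le> n \<and> n < 2 * N \<and> \<not> representable c n}) * card Q
    \<le> 36 * L\<^sup>2 * (N + 2 * (1 + ln X) / (g * (1 - g) * (Y powr (c - 1) / 2) * (2 * real N) powr (g - 2)))"
proof -
  define A where "A = {n. N \<le> n \<and> n < 2 * N \<and> \<not> representable c n}"
  define M where "M = N + 2 * (1 + ln X) / (g * (1 - g) * (Y powr (c - 1) / 2) * (2 * real N) powr (g - 2))"
  define a where "a q = real_of_int \<lfloor>real q powr c\<rfloor>" for q :: nat
  define S where "S h n = norm (\<Sum>q\<in>Q. cis (2 * pi * (real h * (real n - a q) powr g)))" for h n :: nat
  have g: "0 < g" "g < 1" using c by (auto simp: g_def)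
  have Q_sub: "Q \<subseteq> {1..nat \<lfloor>X\<rfloor>}"
  proof
    fix q assume "q \<in> Q"
    then have "0 < q" "real q \<le> X" using Q prime_gt_0_nat by auto
    then show "q \<in> {1..nat \<lfloor>X\<rfloor>}" by (simp add: le_nat_floor Suc_leI)
  qed
  then have fin: "finite Q" by (rule finite_subset) simp
  have aQ: "0 \<le> a q" "a q \<le> X powr c" if "q \<in> Q" for q
  proof -
    have "q powr c \<le> X powr c" using Q[OF that] c by (intro powr_mono2) auto
    then show "a q \<le> X powr c" unfolding a_def by linarith
  qed (simp add: a_def)
  have pointwise: "real (card Q) \<le> 6 * (\<Sum>h=1..L. S h n)" if n: "n \<in> A" for n
  proof -
    define z where "z q = cis (2 * pi * ((real n - a q) powr g + 1 / real (L + 1)))" for q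
    have "real (card Q) \<le> 6 * (\<Sum>h=1..L. norm (\<Sum>q\<in>Q. z q ^ h))"
    proof (rule card_le_sum_norm_power_sums[OF fin L])
      fix q assume q: "q \<in> Q"
      have "q powr c \<le> X powr c" using Q[OF q] c by (intro powr_mono2) auto
      then have "q powr c \<le> real N / 2" using X by linarith
      then show "Re (z q) \<le> cos (2 * pi / real (L + 1))"
        using representable_if_cos_gt[of c q N n L] c Q[OF q] n L gap
        by (force simp: A_def g_def z_def a_def)
    qed (simp add: z_def)
    also have "(\<Sum>h=1..L. norm (\<Sum>q\<in>Q. z q ^ h)) = (\<Sum>h=1..L. S h n)"
    proof (intro sum.cong refl)
      fix h
      \<comment> \<open>The centring shift contributes a factor independent of \<open>q\<close> and
        of modulus 1, so it disappears from the norm.\<close>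
      have "z q ^ h = cis (2 * pi * h / real (L + 1)) * cis (2 * pi * (real h * (real n - a q) powr g))" for q
        unfolding z_def Complex.DeMoivre cis_mult by (simp add: algebra_simps)
      then show "norm (\<Sum>q\<in>Q. z q ^ h) = S h n"
        by (simp only: sum_distrib_left[symmetric] norm_mult norm_cis S_def mult_1)
    qed
    finally show ?thesis .
  qed
  have pointwise2: "(real (card Q))\<^sup>2 \<le> 36 * L * (\<Sum>h=1..L. (S h n)\<^sup>2)" if n: "n \<in> A" for n
  proof -
    have "(real (card Q))\<^sup>2 \<le> (6 * (\<Sum>h=1..L. S h n))\<^sup>2"
      using pointwise[OF n] by (intro power_mono) auto
    also have "\<dots> = 36 * (\<Sum>h=1..L. S h n)\<^sup>2" by (simp add: power_mult_distrib)
    also have "(\<Sum>h=1..L. S h n)\<^sup>2 \<le> (\<Sum>h=1..L. (S h n)\<^sup>2) * real (card {1..L})"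
      by (rule sum_squared_le_sum_of_squares)
    finally show ?thesis by (simp add: mult_ac)
  qed
  have mean: "(\<Sum>n\<in>A. (S h n)\<^sup>2) \<le> card Q * M" if h: "h \<in> {1..L}" for h
  proof -
    have h1: "1 \<le> real h" "real h \<le> L" using h by auto
    have "(\<Sum>n\<in>A. (S h n)\<^sup>2) \<le> (\<Sum>n\<in>(\<lambda>j. N + j) ` {..<N}. (S h n)\<^sup>2)"
    proof (intro sum_mono2)
      show "A \<subseteq> (\<lambda>j. N + j) ` {..<N}"
      proof
        fix n assume "n \<in> A"
        then have "n = N + (n - N)" "n - N < N" by (auto simp: A_def)
        then show "n \<in> (\<lambda>j. N + j) ` {..<N}" by blast
      qed
    qed auto
    also have "\<dots> = (\<Sum>j<N. (S h (N + j))\<^sup>2)" by (subst sum.reindex) auto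
    also have "\<dots> \<le> card Q * (N + 2 * (1 + ln (nat \<lfloor>X\<rfloor>))
        / (h * g * (1 - g) * (Y powr (c - 1) / 2) * (2 * real N) powr (g - 2)))"
      unfolding S_def
    proof (rule mean_square_exponential_sum_le[OF g _ N _ Q_sub])
      show "h * g * (1 - g) * X powr c * (real N / 2) powr (g - 2) \<le> 1 / 2"
      proof -
        have "h * g * (1 - g) * X powr c * (real N / 2) powr (g - 2)
            \<le> L * g * (1 - g) * X powr c * (real N / 2) powr (g - 2)"
          using g h1 by (intro mult_right_mono) auto
        then show ?thesis using small by linarith
      qed
      show "Y powr (c - 1) / 2 * (real q - real r) \<le> a q - a r" if "q \<in> Q" "r \<in> Q" "r < q" for q r
        unfolding a_def using that Q Y c by (intro floor_powr_spacing) auto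
    qed (use aQ X Y h1 in auto)
    also have "\<dots> \<le> card Q * M"
      unfolding M_def
    proof (rule mult_left_mono, rule add_left_mono, rule frac_le)
      have "0 < real (nat \<lfloor>X\<rfloor>)" "real (nat \<lfloor>X\<rfloor>) \<le> X" using X by auto
      then show "2 * (1 + ln (nat \<lfloor>X\<rfloor>)) \<le> 2 * (1 + ln X)" by simp
      show "0 < g * (1 - g) * (Y powr (c - 1) / 2) * (2 * real N) powr (g - 2)"
        using g Y N by simp
      then have "1 * (g * (1 - g) * (Y powr (c - 1) / 2) * (2 * real N) powr (g - 2))
          \<le> h * (g * (1 - g) * (Y powr (c - 1) / 2) * (2 * real N) powr (g - 2))"
        using h1 by (intro mult_right_mono) auto
      then show "g * (1 - g) * (Y powr (c - 1) / 2) * (2 * real N) powr (g - 2)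
          \<le> h * g * (1 - g) * (Y powr (c - 1) / 2) * (2 * real N) powr (g - 2)"
        by (simp add: mult.assoc)
    qed (use X in auto)
    finally show ?thesis .
  qed
  have "real (card A) * (real (card Q))\<^sup>2 = (\<Sum>n\<in>A. (real (card Q))\<^sup>2)" by simp
  also have "\<dots> \<le> (\<Sum>n\<in>A. 36 * L * (\<Sum>h=1..L. (S h n)\<^sup>2))" by (intro sum_mono pointwise2)
  also have "\<dots> = 36 * L * (\<Sum>h=1..L. \<Sum>n\<in>A. (S h n)\<^sup>2)"
    unfolding sum_distrib_left[symmetric] by (subst sum.swap) (rule refl)
  also have "\<dots> \<le> 36 * L * (\<Sum>h=1..L. card Q * M)" by (intro mult_left_mono sum_mono mean) auto
  also have "\<dots> = (36 * L\<^sup>2 * M) * card Q" by (simp add: power2_eq_square)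
  finally have *: "(card A * real (card Q)) * card Q \<le> (36 * L\<^sup>2 * M) * card Q"
    by (simp add: power2_eq_square mult.assoc)
  have "0 \<le> M" using g X by (simp add: M_def)
  \<comment> \<open>If \<open>card Q = 0\<close>, nothing can be cancelled, but the left side is 0
    and \<open>M\<close> is nonnegative.\<close>
  then have "card A * real (card Q) \<le> 36 * L\<^sup>2 * M"
    using * by (cases "card Q = 0") (auto simp: mult_le_cancel_right)
  then show ?thesis by (simp add: A_def M_def)
qed

section \<open>Choice of the parameters as powers of \<open>N\<close>\<close>

lemma eventually_le_powr:
  fixes K \<delta> :: real
  assumes "0 < \<delta>"
  shows "\<forall>\<^sub>F N :: nat in sequentially. K \<le> real N powr \<delta>"
proof -
  obtain M :: nat where M: "max K 1 powr (1 / \<delta>) \<le> real M" using real_arch_simple by blast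
  have "K \<le> real N powr \<delta>" if "M \<le> N" for N
  proof -
    have "K \<le> (max K 1 powr (1 / \<delta>)) powr \<delta>" using assms by (simp add: powr_powr)
    also have "\<dots> \<le> real N powr \<delta>" using M that assms by (intro powr_mono2) auto
    finally show ?thesis .
  qed
  then show ?thesis unfolding eventually_sequentially by blast
qed

text \<open>Chebyshev's bound produces at least 2 Y primes up to X, of which at most Y lie below Y.
  The quotient X / Y is split as t * t with \<open>t = N powr (\<eta> / 2)\<close>: one factor
  absorbs the logarithm, the other the constant 16 / \<eta>.\<close>

lemma card_primes_between_ge:
  fixes N :: nat and \<alpha> \<eta> :: real
  assumes \<eta>: "0 < \<eta>" "\<eta> < 1" "\<eta> \<le> \<alpha>" "\<alpha> \<le> 1" and N: "1 \<le> N"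
    and large: "6 \<le> N powr \<alpha>" "16 / \<eta> \<le> N powr (\<eta> / 2)"
  shows "N powr (\<alpha> - \<eta>) \<le> card {p. prime p \<and> N powr (\<alpha> - \<eta>) \<le> real p \<and> real p \<le> N powr \<alpha>}"
proof -
  define X where "X = real N powr \<alpha>"
  define Y where "Y = real N powr (\<alpha> - \<eta>)"
  define P where "P = {p. prime p \<and> real p \<le> X}"
  define Q where "Q = {p. prime p \<and> Y \<le> real p \<and> real p \<le> X}"
  define t where "t = real N powr (\<eta> / 2)"
  have t: "0 < t" "16 / \<eta> \<le> t" using N large by (auto simp: t_def)
  have Y0: "0 < Y" using N by (simp add: Y_def)
  have XY: "X = Y * t * t"
    unfolding X_def Y_def t_def using N by (simp flip: powr_add)
  have finP: "finite P" by (rule finite_subset[of _ "{..nat \<lfloor>X\<rfloor>}"]) (auto simp: P_def le_nat_floor)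
  have "ln X = \<alpha> * ln (real N)" unfolding X_def using N by (simp add: ln_powr)
  also have "\<dots> \<le> 1 * ln (real N)" using N \<eta> by (intro mult_right_mono) auto
  also have "\<dots> \<le> t / (\<eta> / 2)"
    unfolding t_def using ln_powr_bound[of "real N" "\<eta> / 2"] N \<eta> by simp
  finally have lnX: "ln X \<le> 2 * t / \<eta>" by (simp add: mult.commute)
  have "X / 4 \<le> (X - 3) / 2" using large by (simp add: X_def)
  also have "\<dots> \<le> card P * ln X"
    unfolding P_def using large by (intro chebyshev_lower_bound) (simp add: X_def)
  also have "\<dots> \<le> card P * (2 * t / \<eta>)" using lnX by (intro mult_left_mono) auto
  finally have "X / 4 \<le> card P * (2 * t / \<eta>)" .
  then have "t * (Y * t * \<eta>) \<le> t * (8 * card P)"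
    unfolding XY using \<eta> by (simp add: field_simps)
  then have 1: "Y * t * \<eta> \<le> 8 * card P" using t by simp
  have "16 \<le> t * \<eta>" using t \<eta> by (simp add: field_simps)
  then have "Y * 16 \<le> Y * (t * \<eta>)" using Y0 by (intro mult_left_mono) auto
  with 1 have cP: "2 * Y \<le> card P" by (simp add: mult.assoc)
  have "P \<subseteq> Q \<union> {1..nat \<lfloor>Y\<rfloor>}"
  proof
    fix p assume "p \<in> P"
    then show "p \<in> Q \<union> {1..nat \<lfloor>Y\<rfloor>}"
      by (cases "Y \<le> real p") (auto simp: P_def Q_def le_nat_floor prime_ge_1_nat Suc_le_eq prime_gt_0_nat)
  qed
  moreover have "finite Q" by (rule finite_subset[OF _ finP]) (auto simp: P_def Q_def)
  ultimately have "card P \<le> card (Q \<union> {1..nat \<lfloor>Y\<rfloor>})" by (intro card_mono) auto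
  also have "\<dots> \<le> card Q + card {1..nat \<lfloor>Y\<rfloor>}" by (rule card_Un_le)
  finally have "real (card P) \<le> card Q + real (nat \<lfloor>Y\<rfloor>)" by simp
  also have "real (nat \<lfloor>Y\<rfloor>) \<le> Y" using Y0 by simp
  finally have "Y \<le> card Q" using cP by simp
  then show ?thesis by (simp add: Y_def Q_def X_def)
qed

text \<open>With \<open>L\<close> of order 1 - g, the mean square factor of order 1 + 2 \<eta> and
  at least \<open>Y\<close> primes, of order g - 2 \<eta>, the exponent of \<open>N\<close> is 2 (1
  - g) + (1 + 2 \<eta>) - (g - 2 \<eta>) = 3 (1 - g) + 4 \<eta>. The factor 1764 is 36 times the
  square of 7.\<close>

lemma exceptional_block_bound_explicit:
  fixes c g \<eta> :: real and N :: nat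
  assumes c: "1 < c" "c < 3 / 2" and g_def: "g = 1 / c" and \<eta>: "0 < \<eta>" "\<eta> \<le> 1 / 8"
    and N: "1 \<le> N"
    and large: "2 \<le> N powr ((g - 2 * \<eta>) * (c - 1))" "56 \<le> N powr (\<eta> * c)"
      "6 \<le> N powr (g - \<eta>)" "16 / \<eta> \<le> N powr (\<eta> / 2)"
  shows "real (card {n. N \<le> n \<and> n < 2 * N \<and> \<not> representable c n})
    \<le> 1764 * (1 + 16 * (1 + 1 / \<eta>) / (g * (1 - g))) * N powr (3 * (1 - g) + 4 * \<eta>)"
proof -
  define X where "X = real N powr (g - \<eta>)"
  define Y where "Y = real N powr (g - 2 * \<eta>)"
  define Q where "Q = {p. prime p \<and> Y \<le> real p \<and> real p \<le> X}"
  define L where "L = nat \<lceil>2 / g * (2 * real N) powr (1 - g)\<rceil>"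
  define A where "A = {n. N \<le> n \<and> n < 2 * N \<and> \<not> representable c n}"
  define C where "C = 1 + 16 * (1 + 1 / \<eta>) / (g * (1 - g))"
  have g: "2 / 3 < g" "g < 1" using c by (auto simp: g_def field_simps)
  have gc: "g * c = 1" using c by (simp add: g_def)
  have N1: "1 \<le> real N" using N by simp
  have N0: "0 < real N" using N by simp
  have kappa: "0 < g * (1 - g)" "g * (1 - g) \<le> 1"
    using g mult_mono[of g 1 "1 - g" 1] by auto
  have L_ge: "2 / g * (2 * real N) powr (1 - g) \<le> L"
    unfolding L_def by linarith
  have two: "(1::real) \<le> 2 powr (1 - g)" "(2::real) powr (1 - g) \<le> 2"
    using g powr_mono[of 0 "1 - g" "2::real"] powr_mono[of "1 - g" 1 "2::real"] by auto
  have Npow: "1 \<le> real N powr (1 - g)" using g N1 by (intro ge_one_powr_ge_zero) auto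
  have expand: "(2 * real N) powr (1 - g) = 2 powr (1 - g) * real N powr (1 - g)"
    using N0 by (simp add: powr_mult)
  have L2: "2 \<le> L"
  proof -
    have "1 * 1 \<le> (2 * real N) powr (1 - g)"
      unfolding expand using two Npow by (intro mult_mono) auto
    moreover have "2 < 2 / g" using g by (simp add: field_simps)
    ultimately have "2 * 1 \<le> 2 / g * (2 * real N) powr (1 - g)" using g by (intro mult_mono) auto
    with L_ge show ?thesis by linarith
  qed
  \<comment> \<open>The constant is 7 = 3 * 2 + 1: \<open>c < 3 / 2\<close> gives 2 / g < 3, the
    power of 2 is at most 2, and the ceiling adds at most 1.\<close>
  have L_le: "L \<le> 7 * N powr (1 - g)"
  proof -
    have "0 \<le> 2 / g * (2 * real N) powr (1 - g)" using g by simp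
    then have "L \<le> 2 / g * (2 * real N) powr (1 - g) + 1" unfolding L_def by linarith
    also have "\<dots> \<le> 3 * (2 * N powr (1 - g)) + N powr (1 - g)"
      unfolding expand using g two Npow
      by (intro add_mono mult_mono mult_right_mono) (auto simp: field_simps)
    finally show ?thesis by simp
  qed
  have Xc: "X powr c = N powr (1 - \<eta> * c)"
    unfolding X_def powr_powr using gc by (simp add: algebra_simps)
  \<comment> \<open>The phase derivative will be bounded by 28 = 7 * 4 times this power, so 1/56 is
    what brings it down to 1/2.\<close>
  have small_pow: "N powr (- (\<eta> * c)) \<le> 1 / 56"
    using le_imp_inverse_le[OF large(2)] by (simp add: powr_minus)
  have "real (card A) * card Q
      \<le> 36 * L\<^sup>2 * (N + 2 * (1 + ln X) / (g * (1 - g) * (Y powr (c - 1) / 2) * (2 * real N) powr (g - 2)))"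
    unfolding A_def
  proof (rule card_exceptional_mult_card_primes_le[OF c(1) g_def _ L2])
    show "0 < N" using N by simp
    show "prime q \<and> Y \<le> real q \<and> real q \<le> X" if "q \<in> Q" for q using that by (simp add: Q_def)
    show "0 < Y" using N0 by (simp add: Y_def)
    show "2 \<le> Y powr (c - 1)" using large(1) by (simp add: Y_def powr_powr)
    show "1 \<le> X" using large(3) by (simp add: X_def)
    have "X powr c = N powr (- (\<eta> * c)) * N"
      unfolding Xc using powr_add[of "real N" "- (\<eta> * c)" 1] N0 by simp
    also have "\<dots> \<le> 1 / 56 * N" using small_pow by (intro mult_right_mono) auto
    finally show "X powr c \<le> real N / 2" using N0 by simp
    have "2 / real (L + 1) \<le> 2 / (2 / g * (2 * real N) powr (1 - g))"
      using L_ge g N0 by (intro divide_left_mono) auto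
    also have "\<dots> = g * (2 * real N) powr (g - 1)"
      using powr_minus_divide[of "2 * real N" "1 - g"] g by simp
    finally show "2 / real (L + 1) \<le> g * (2 * real N) powr (g - 1)" .
    have half: "(real N / 2) powr (g - 2) \<le> 4 * N powr (g - 2)"
    proof -
      have "(real N / 2) powr (g - 2) = N powr (g - 2) * 2 powr (2 - g)"
        using N0 powr_minus_divide[of 2 "2 - g"] by (simp add: powr_divide)
      also have "\<dots> \<le> N powr (g - 2) * 2 powr 2"
        using g by (intro mult_left_mono powr_mono) auto
      finally show ?thesis by simp
    qed
    have "L * g * (1 - g) * X powr c * (real N / 2) powr (g - 2)
        = L * (g * (1 - g)) * N powr (1 - \<eta> * c) * (real N / 2) powr (g - 2)"
      by (simp add: Xc mult.assoc)
    also have "\<dots> \<le> 7 * N powr (1 - g) * 1 * N powr (1 - \<eta> * c) * (4 * N powr (g - 2))"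
      using L_le kappa half g by (intro mult_mono mult_right_mono mult_nonneg_nonneg) auto
    also have "\<dots> = 28 * (N powr (1 - g) * N powr (1 - \<eta> * c) * N powr (g - 2))" by simp
    also have "N powr (1 - g) * N powr (1 - \<eta> * c) * N powr (g - 2) = N powr (- (\<eta> * c))"
      by (simp flip: powr_add)
    finally show "L * g * (1 - g) * X powr c * (real N / 2) powr (g - 2) \<le> 1 / 2"
      using small_pow by simp
  qed
  also have "\<dots> \<le> 36 * (7 * N powr (1 - g))\<^sup>2 * (C * N powr (1 + 2 * \<eta>))"
  proof (rule mult_mono)
    have "(real L)\<^sup>2 \<le> (7 * N powr (1 - g))\<^sup>2" using L_le by (intro power_mono) auto
    then show "real (36 * L\<^sup>2) \<le> 36 * (7 * N powr (1 - g))\<^sup>2" by simp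
    have "1 \<le> X" using large(3) by (simp add: X_def)
    then have lnX0: "0 \<le> ln X" by (rule ln_ge_zero)
    have "ln X = (g - \<eta>) * ln N" unfolding X_def using N0 by (simp add: ln_powr)
    also have "\<dots> \<le> 1 * ln N" using N1 g \<eta> by (intro mult_right_mono) auto
    also have "\<dots> \<le> N powr \<eta> / \<eta>" using ln_powr_bound[of N \<eta>] N1 \<eta> by simp
    finally have "1 + ln X \<le> N powr \<eta> + N powr \<eta> / \<eta>"
      using ge_one_powr_ge_zero[of "real N" \<eta>] N1 \<eta> by simp
    then have lnX: "1 + ln X \<le> (1 + 1 / \<eta>) * N powr \<eta>" by (simp add: algebra_simps)
    have "(2 * real N) powr (g - 2) = N powr (g - 2) * 2 powr (g - 2)"
      using N0 by (simp add: powr_mult)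
    also have "\<dots> \<ge> N powr (g - 2) * 2 powr (- 2)"
      using g by (intro mult_left_mono powr_mono) auto
    finally have twoN: "N powr (g - 2) / 4 \<le> (2 * real N) powr (g - 2)"
      by (simp add: powr_minus)
    \<comment> \<open>Here \<open>c < 3 / 2\<close> gives 2 (c - 1) \<le> 1. Since g (c - 1) = 1 -
      g, the exponent of \<open>Y powr (c - 1)\<close> loses at most \<eta> against 1 - g.\<close>
    have "(2 * \<eta>) * (c - 1) \<le> \<eta> * 1" using c \<eta> by (simp only: mult.assoc mult.left_commute) (intro mult_left_mono, auto)
    then have "1 - g - \<eta> \<le> (g - 2 * \<eta>) * (c - 1)" using gc by (simp add: algebra_simps)
    then have Yc: "N powr (1 - g - \<eta>) \<le> Y powr (c - 1)"
      unfolding Y_def powr_powr using N1 by (intro powr_mono) auto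
    have rearrange: "2 * (a * b) / (k * (u / 2) * (v / 4)) = 16 * a / k * (b / (u * v))"
      for a b k u v :: real
      by simp
    have "2 * (1 + ln X) / (g * (1 - g) * (Y powr (c - 1) / 2) * (2 * real N) powr (g - 2))
        \<le> 2 * ((1 + 1 / \<eta>) * N powr \<eta>) / (g * (1 - g) * (N powr (1 - g - \<eta>) / 2) * (N powr (g - 2) / 4))"
    proof (intro frac_le mult_mono mult_left_mono divide_right_mono Yc twoN lnX)
      show "0 < g * (1 - g) * (N powr (1 - g - \<eta>) / 2) * (N powr (g - 2) / 4)"
        using kappa N0 by simp
    qed (use kappa \<eta> g lnX0 in auto)
    also have "\<dots> = 16 * (1 + 1 / \<eta>) / (g * (1 - g)) * (N powr \<eta> / (N powr (1 - g - \<eta>) * N powr (g - 2)))"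
      by (rule rearrange)
    also have "N powr \<eta> / (N powr (1 - g - \<eta>) * N powr (g - 2)) = N powr (1 + 2 * \<eta>)"
      by (simp add: algebra_simps flip: powr_add powr_diff)
    finally have 2: "2 * (1 + ln X) / (g * (1 - g) * (Y powr (c - 1) / 2) * (2 * real N) powr (g - 2))
        \<le> 16 * (1 + 1 / \<eta>) / (g * (1 - g)) * N powr (1 + 2 * \<eta>)" .
    have "real N = N powr 1" using N0 by simp
    also have "\<dots> \<le> N powr (1 + 2 * \<eta>)" using N1 \<eta> by (intro powr_mono) auto
    finally show "N + 2 * (1 + ln X) / (g * (1 - g) * (Y powr (c - 1) / 2) * (2 * real N) powr (g - 2))
        \<le> C * N powr (1 + 2 * \<eta>)"
      using 2 by (simp add: C_def distrib_right)
    show "0 \<le> N + 2 * (1 + ln X) / (g * (1 - g) * (Y powr (c - 1) / 2) * (2 * real N) powr (g - 2))"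
      using kappa lnX0 by simp
  qed auto
  also have "\<dots> = 1764 * C * (N powr (1 - g) * N powr (1 - g) * N powr (1 + 2 * \<eta>))"
    by (simp add: power2_eq_square)
  also have "N powr (1 - g) * N powr (1 - g) * N powr (1 + 2 * \<eta>) = N powr (3 * (1 - g) + 4 * \<eta>) * Y"
    unfolding Y_def by (simp flip: powr_add add: algebra_simps)
  finally have "real (card A) * card Q \<le> (1764 * C * N powr (3 * (1 - g) + 4 * \<eta>)) * Y" by (simp add: mult.assoc)
  moreover have "Y \<le> card Q"
  proof -
    have "g - \<eta> - \<eta> = g - 2 * \<eta>" by simp
    then show ?thesis
      using card_primes_between_ge[of \<eta> "g - \<eta>" N] \<eta> g N large by (simp add: Y_def Q_def X_def)
  qed
  then have "real (card A) * Y \<le> real (card A) * card Q" by (intro mult_left_mono) auto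
  ultimately have "real (card A) * Y \<le> (1764 * C * N powr (3 * (1 - g) + 4 * \<eta>)) * Y" by linarith
  moreover have "0 < Y" using N0 by (simp add: Y_def)
  ultimately have "real (card A) \<le> 1764 * C * N powr (3 * (1 - g) + 4 * \<eta>)"
    by (rule mult_right_le_imp_le)
  then show ?thesis by (simp only: A_def C_def)
qed

text \<open>The explicit bound applies from some \<open>K\<close> on, with \<eta> chosen so that
  \<open>4 * \<eta> \<le> \<epsilon>\<close>. A block with \<open>N < K\<close> has fewer than
  \<open>K\<close> elements, and since \<open>N powr \<sigma>\<close> is at least 1, adding
  \<open>K\<close> to the constant accounts for it.\<close>

lemma exceptional_block_bound:
  fixes c \<epsilon> :: real
  assumes c: "1 < c" "c < 3 / 2" and \<epsilon>: "0 < \<epsilon>"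
  shows "\<exists>C>0. \<forall>N\<ge>1::nat. real (card {n. N \<le> n \<and> n < 2 * N \<and> \<not> representable c n})
    \<le> C * N powr (3 * (1 - 1 / c) + \<epsilon>)"
proof -
  define g where "g = 1 / c"
  define \<eta> where "\<eta> = min (\<epsilon> / 4) (1 / 8)"
  define \<sigma> where "\<sigma> = 3 * (1 - g) + \<epsilon>"
  define B where "B = 1764 * (1 + 16 * (1 + 1 / \<eta>) / (g * (1 - g)))"
  have g: "2 / 3 < g" "g < 1" using c by (auto simp: g_def field_simps)
  have \<eta>: "0 < \<eta>" "\<eta> \<le> 1 / 8" "4 * \<eta> \<le> \<epsilon>" using \<epsilon> by (auto simp: \<eta>_def)
  have B: "0 < B" using g \<eta> unfolding B_def by (intro mult_pos_pos add_pos_nonneg) auto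
  have \<sigma>: "0 < \<sigma>" using g \<epsilon> by (simp add: \<sigma>_def)
  have pos: "0 < (g - 2 * \<eta>) * (c - 1)" "0 < \<eta> * c" "0 < g - \<eta>" "0 < \<eta> / 2"
    using g \<eta> c by (simp_all add: mult_pos_pos)
  have "\<forall>\<^sub>F N :: nat in sequentially. (1::nat) \<le> N \<and> 2 \<le> N powr ((g - 2 * \<eta>) * (c - 1)) \<and> 56 \<le> N powr (\<eta> * c)
      \<and> 6 \<le> N powr (g - \<eta>) \<and> 16 / \<eta> \<le> N powr (\<eta> / 2)"
    by (intro eventually_conj eventually_le_powr eventually_ge_at_top pos)
  then obtain K where K: "(1::nat) \<le> N \<and> 2 \<le> N powr ((g - 2 * \<eta>) * (c - 1)) \<and> 56 \<le> N powr (\<eta> * c)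
      \<and> 6 \<le> N powr (g - \<eta>) \<and> 16 / \<eta> \<le> N powr (\<eta> / 2)" if "K \<le> N" for N :: nat
    unfolding eventually_sequentially by blast
  have "real (card {n. N \<le> n \<and> n < 2 * N \<and> \<not> representable c n}) \<le> (B + K) * N powr \<sigma>"
    if N: "1 \<le> N" for N :: nat
  proof (cases "K \<le> N")
    case True
    have "real (card {n. N \<le> n \<and> n < 2 * N \<and> \<not> representable c n}) \<le> B * N powr (3 * (1 - g) + 4 * \<eta>)"
      unfolding B_def using K[OF True] by (intro exceptional_block_bound_explicit c g_def \<eta>) auto
    also have "\<dots> \<le> (B + K) * N powr \<sigma>"
      using N B \<eta> by (intro mult_mono powr_mono) (auto simp: \<sigma>_def)
    finally show ?thesis .
  next
    case False
    have "card {n. N \<le> n \<and> n < 2 * N \<and> \<not> representable c n} \<le> card {N..<2 * N}"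
      by (intro card_mono) auto
    then have "real (card {n. N \<le> n \<and> n < 2 * N \<and> \<not> representable c n}) \<le> real K * 1"
      using False by simp
    also have "\<dots> \<le> (B + K) * N powr \<sigma>"
      using N B \<sigma> by (intro mult_mono ge_one_powr_ge_zero) auto
    finally show ?thesis .
  qed
  then show ?thesis using B by (intro exI[of _ "B + K"]) (auto simp: \<sigma>_def g_def)
qed

section \<open>Summation over dyadic blocks\<close>

lemma card_dyadic_sum_le:
  fixes C \<sigma> :: real and P :: "nat \<Rightarrow> bool"
  assumes \<sigma>: "0 < \<sigma>" and C: "0 < C"
    and block: "\<And>N :: nat. 1 \<le> N \<Longrightarrow> real (card {n. N \<le> n \<and> n < 2 * N \<and> P n}) \<le> C * N powr \<sigma>"
    and x: "1 \<le> x"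
  shows "real (card {n. 0 < n \<and> real n \<le> x \<and> P n}) \<le> C * 2 powr \<sigma> / (2 powr \<sigma> - 1) * x powr \<sigma>"
proof -
  define r where "r = (2::real) powr \<sigma>"
  have r: "1 < r" using \<sigma> by (simp add: r_def)
  have pow: "real (2 ^ k) powr \<sigma> = r ^ k" for k :: nat
    by (simp add: r_def powr_powr mult.commute flip: powr_realpow)
  \<comment> \<open>The constant solves C / (r - 1) + C = r C / (r - 1), so the geometric growth
    closes the induction.\<close>
  have dyadic: "real (card {n. 0 < n \<and> n < 2 ^ k \<and> P n}) \<le> C / (r - 1) * r ^ k" for k
  proof (induction k)
    case 0
    have "{n. 0 < n \<and> n < 2 ^ 0 \<and> P n} = {}" by auto
    then have "card {n. 0 < n \<and> n < 2 ^ 0 \<and> P n} = 0" by (simp only: card.empty)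
    then show ?case using r C by (simp only: of_nat_0) simp
  next
    case (Suc k)
    have "{n. 0 < n \<and> n < 2 ^ Suc k \<and> P n}
        = {n. 0 < n \<and> n < 2 ^ k \<and> P n} \<union> {n. 2 ^ k \<le> n \<and> n < 2 * 2 ^ k \<and> P n}"
      by (auto intro: less_le_trans[of 0 "2 ^ k"])
    then have "card {n. 0 < n \<and> n < 2 ^ Suc k \<and> P n}
        \<le> card {n. 0 < n \<and> n < 2 ^ k \<and> P n} + card {n. 2 ^ k \<le> n \<and> n < 2 * 2 ^ k \<and> P n}"
      by (simp only: card_Un_le)
    then have "real (card {n. 0 < n \<and> n < 2 ^ Suc k \<and> P n})
        \<le> real (card {n. 0 < n \<and> n < 2 ^ k \<and> P n}) + real (card {n. 2 ^ k \<le> n \<and> n < 2 * 2 ^ k \<and> P n})"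
      by (simp only: of_nat_add[symmetric] of_nat_le_iff)
    also have "\<dots> \<le> C / (r - 1) * r ^ k + C * r ^ k"
      using Suc.IH block[of "2 ^ k", unfolded pow] by (intro add_mono) auto
    also have "\<dots> = C / (r - 1) * r ^ Suc k" using r by (simp add: field_simps)
    finally show ?case .
  qed
  \<comment> \<open>The blocks must reach 2 ^ (k + 1), which may exceed \<open>x\<close>; the
    overshoot costs the extra factor \<open>r\<close>.\<close>
  obtain k where k: "2 ^ k \<le> nat \<lfloor>x\<rfloor>" "nat \<lfloor>x\<rfloor> < 2 ^ (k + 1)"
    using ex_power_ivl1[of 2 "nat \<lfloor>x\<rfloor>"] x by (auto simp: le_nat_floor)
  have "real (2 ^ k) \<le> real (nat \<lfloor>x\<rfloor>)" using k(1) by (rule of_nat_mono)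
  then have kx: "real (2 ^ k) \<le> x" using x by linarith
  have "{n. 0 < n \<and> real n \<le> x \<and> P n} \<subseteq> {n. 0 < n \<and> n < 2 ^ (k + 1) \<and> P n}"
    using k(2) by (auto dest: le_nat_floor)
  then have "card {n. 0 < n \<and> real n \<le> x \<and> P n} \<le> card {n. 0 < n \<and> n < 2 ^ (k + 1) \<and> P n}"
    by (intro card_mono) auto
  then have "real (card {n. 0 < n \<and> real n \<le> x \<and> P n}) \<le> C / (r - 1) * r ^ (k + 1)"
    using dyadic[of "k + 1"] by linarith
  also have "\<dots> = C * r / (r - 1) * real (2 ^ k) powr \<sigma>" unfolding pow by simp
  also have "\<dots> \<le> C * r / (r - 1) * x powr \<sigma>"
    using r C kx \<sigma> by (intro mult_left_mono powr_mono2) auto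
  finally show ?thesis by (simp add: r_def)
qed

theorem theorem2:
  fixes c \<epsilon> :: real
  assumes "1 < c" and "c < 3 / 2" and "\<epsilon> > 0"
  shows "\<exists>C>0. \<forall>x\<ge>2. real (exceptional_count c x) \<le> C * x powr (3 * (1 - 1 / c) + \<epsilon>)"
proof -
  define \<sigma> where "\<sigma> = 3 * (1 - 1 / c) + \<epsilon>"
  have "1 / c < 1" using assms by simp
  then have \<sigma>: "0 < \<sigma>" using assms(3) by (simp add: \<sigma>_def)
  then have r: "1 < (2::real) powr \<sigma>" by simp
  obtain C where C: "0 < C"
      "\<And>N :: nat. 1 \<le> N \<Longrightarrow> real (card {n. N \<le> n \<and> n < 2 * N \<and> \<not> representable c n}) \<le> C * N powr \<sigma>"
    using exceptional_block_bound[OF assms] unfolding \<sigma>_def by blast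
  have "real (exceptional_count c x) \<le> C * 2 powr \<sigma> / (2 powr \<sigma> - 1) * x powr \<sigma>" if "2 \<le> x" for x
    unfolding exceptional_count_def using card_dyadic_sum_le[OF \<sigma> C] that by simp
  then show ?thesis
    using r C(1) unfolding \<sigma>_def[symmetric]
    by (intro exI[of _ "C * 2 powr \<sigma> / (2 powr \<sigma> - 1)"]) auto
qed

end
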